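(* Let $M$ be a connected differentiable manifold with a Riemannian metric $\alpha$, let $\beta$ be a one-form on $M$ whose dual vector field $\beta^{\sharp}$ satisfies $\alpha(\beta^{\sharp},\beta^{\sharp})<1$ at every point, and suppose that the Randers metric $F(v)=\sqrt{\alpha(v,v)}+\beta(v)$ is a generalized Berwald metric, with $\beta^{\sharp}$ of constant Riemannian length $K\neq 0$. Let $\nabla^*$ be the Lévi-Civita connection of $\alpha$ and put $$T^{\circ}(X,Y)=\frac{\alpha(\nabla^*_X\beta^{\sharp},Y)}{K^2}\beta^{\sharp}-\frac{\alpha(Y,\beta^{\sharp})}{K^2}\nabla^*_X\beta^{\sharp}-\frac{\alpha(\nabla^*_Y\beta^{\sharp},X)}{K^2}\beta^{\sharp}+\frac{\alpha(X,\beta^{\sharp})}{K^2}\nabla^*_Y\beta^{\sharp}.$$ Then the torsion $T$ of the extremal compatible linear connection of $F$ satisfies, for all vector fields $X,Y,Z$ on $M$, $$\alpha(T(X,Y),Z)=\alpha(T^{\circ}(X,Y),Z)+\frac{\beta(Y)\,d\beta(X,Z)-\beta(X)\,d\beta(Y,Z)}{2K^2}+\frac{\beta(X)\,d\beta(Y,\beta^{\sharp})-\beta(Y)\,d\beta(X,\beta^{\sharp})}{2K^4}\,\beta(Z).$$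
   Context: All objects are smooth. The dual vector field $\beta^{\sharp}$ is defined by $\alpha(\beta^{\sharp},Y)=\beta(Y)$ for all $Y$. The exterior derivative is normalized as $d\beta(X,Y)=X\beta(Y)-Y\beta(X)-\beta([X,Y])$. A linear connection $\nabla$ on $M$ is compatible with $F\colon TM\to\mathbb{R}$ if the parallel transports with respect to $\nabla$ preserve the Randers norm $F$ of tangent vectors. $F$ is a generalized Berwald metric if it admits a compatible linear connection. The torsion of $\nabla$ is $T(X,Y)=\nabla_XY-\nabla_YX-[X,Y]$. The norm $|T|$ at a point $p$ is induced by $\alpha$: $|T|^2$ is the sum of the squares of the components of $T$ with respect to an $\alpha$-orthonormal basis of $T_pM$. The extremal compatible linear connection of $F$ is the compatible linear connection whose torsion $T$ has, at each point of $M$, minimal norm $|T|^2$ among the torsions of all linear connections compatible with $F$. *)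

theory Defs
  imports "HOL-Analysis.Analysis"
begin

section \<open>Smooth maps between Euclidean spaces\<close>

text \<open>Only used on open sets; the values of the map outside the set are irrelevant there.\<close>

primrec Ck_on :: "nat \<Rightarrow> 'a::real_normed_vector set \<Rightarrow> ('a \<Rightarrow> 'b::real_normed_vector) \<Rightarrow> bool" where
  "Ck_on 0 S f \<longleftrightarrow> continuous_on S f"
| "Ck_on (Suc k) S f \<longleftrightarrow>
     (\<forall>x\<in>S. f differentiable (at x)) \<and> (\<forall>v. Ck_on k S (\<lambda>x. frechet_derivative f (at x) v))"

definition smooth_on :: "'a::real_normed_vector set \<Rightarrow> ('a \<Rightarrow> 'b::real_normed_vector) \<Rightarrow> bool" where
  "smooth_on S f \<longleftrightarrow> (\<forall>k. Ck_on k S f)"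


section \<open>Smooth manifolds\<close>

text \<open>The manifold is a whole Hausdorff, second countable type \<open>'m\<close>, modelled on the Euclidean
  space \<open>'e\<close>. Its smooth structure is given by an atlas, not necessarily a maximal one.\<close>

type_synonym ('m, 'e) chart = "'m set \<times> ('m \<Rightarrow> 'e)"

abbreviation dom_chart :: "('m, 'e) chart \<Rightarrow> 'm set" where
  "dom_chart c \<equiv> fst c"

abbreviation map_chart :: "('m, 'e) chart \<Rightarrow> 'm \<Rightarrow> 'e" where
  "map_chart c \<equiv> snd c"

definition inv_chart :: "('m, 'e) chart \<Rightarrow> 'e \<Rightarrow> 'm" where
  "inv_chart c = inv_into (dom_chart c) (map_chart c)"

definition range_chart :: "('m, 'e) chart \<Rightarrow> 'e set" where
  "range_chart c = map_chart c ` dom_chart c"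

definition transition :: "('m, 'e) chart \<Rightarrow> ('m, 'e) chart \<Rightarrow> 'e \<Rightarrow> 'e" where
  "transition c d = map_chart d \<circ> inv_chart c"

definition is_chart :: "('m::topological_space, 'e::euclidean_space) chart \<Rightarrow> bool" where
  "is_chart c \<longleftrightarrow> open (dom_chart c) \<and> open (range_chart c) \<and>
     homeomorphism (dom_chart c) (range_chart c) (map_chart c) (inv_chart c)"

definition smooth_atlas ::
  "('m::{t2_space,second_countable_topology}, 'e::euclidean_space) chart set \<Rightarrow> bool" where
  "smooth_atlas A \<longleftrightarrow> (\<forall>c\<in>A. is_chart c) \<and> (\<Union>c\<in>A. dom_chart c) = UNIV \<and>
     (\<forall>c\<in>A. \<forall>d\<in>A. smooth_on (map_chart c ` (dom_chart c \<inter> dom_chart d)) (transition c d))"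


section \<open>Tangent vectors and tensor fields\<close>

text \<open>A tangent vector at \<open>p\<close> is the class of a pair (chart around \<open>p\<close>, vector of \<open>'e\<close>), where
  pairs are identified through the derivatives of the transition maps. It is represented by its
  components in the chart \<open>chart_at A p\<close>, so that the tangent space at \<open>p\<close> is \<open>'e\<close>.
  The chart \<open>chart_at A p\<close> jumps with \<open>p\<close>; smoothness is therefore always tested on the
  components with respect to a fixed chart.\<close>

definition chart_at :: "('m, 'e) chart set \<Rightarrow> 'm \<Rightarrow> ('m, 'e) chart" where
  "chart_at A p = (SOME c. c \<in> A \<and> p \<in> dom_chart c)"

text \<open>\<open>to_chart A c p v\<close> are the components in the chart \<open>c\<close> of the tangent vector \<open>v\<close> at \<open>p\<close>;
  \<open>from_chart A c p\<close> is the inverse: the tangent vector at \<open>p\<close> with given components in \<open>c\<close>.\<close>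

definition to_chart ::
  "('m, 'e::euclidean_space) chart set \<Rightarrow> ('m, 'e) chart \<Rightarrow> 'm \<Rightarrow> 'e \<Rightarrow> 'e" where
  "to_chart A c p =
     frechet_derivative (transition (chart_at A p) c) (at (map_chart (chart_at A p) p))"

definition from_chart ::
  "('m, 'e::euclidean_space) chart set \<Rightarrow> ('m, 'e) chart \<Rightarrow> 'm \<Rightarrow> 'e \<Rightarrow> 'e" where
  "from_chart A c p = frechet_derivative (transition c (chart_at A p)) (at (map_chart c p))"

definition smooth_function ::
  "('m, 'e::euclidean_space) chart set \<Rightarrow> ('m \<Rightarrow> real) \<Rightarrow> bool" where
  "smooth_function A f \<longleftrightarrow> (\<forall>c\<in>A. smooth_on (range_chart c) (f \<circ> inv_chart c))"

definition field_in_chart ::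
  "('m, 'e::euclidean_space) chart set \<Rightarrow> ('m, 'e) chart \<Rightarrow> ('m \<Rightarrow> 'e) \<Rightarrow> 'e \<Rightarrow> 'e" where
  "field_in_chart A c X = (\<lambda>p. to_chart A c p (X p)) \<circ> inv_chart c"

definition vector_field ::
  "('m, 'e::euclidean_space) chart set \<Rightarrow> ('m \<Rightarrow> 'e) \<Rightarrow> bool" where
  "vector_field A X \<longleftrightarrow> (\<forall>c\<in>A. smooth_on (range_chart c) (field_in_chart A c X))"

definition one_form ::
  "('m, 'e::euclidean_space) chart set \<Rightarrow> ('m \<Rightarrow> 'e \<Rightarrow> real) \<Rightarrow> bool" where
  "one_form A \<beta> \<longleftrightarrow> (\<forall>p. linear (\<beta> p)) \<and>
     (\<forall>c\<in>A. \<forall>u. smooth_on (range_chart c) ((\<lambda>p. \<beta> p (from_chart A c p u)) \<circ> inv_chart c))"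

definition riemannian_metric ::
  "('m, 'e::euclidean_space) chart set \<Rightarrow> ('m \<Rightarrow> 'e \<Rightarrow> 'e \<Rightarrow> real) \<Rightarrow> bool" where
  "riemannian_metric A \<alpha> \<longleftrightarrow>
     (\<forall>p. bilinear (\<alpha> p) \<and> (\<forall>u v. \<alpha> p u v = \<alpha> p v u) \<and> (\<forall>u. u \<noteq> 0 \<longrightarrow> \<alpha> p u u > 0)) \<and>
     (\<forall>c\<in>A. \<forall>u v. smooth_on (range_chart c)
        ((\<lambda>p. \<alpha> p (from_chart A c p u) (from_chart A c p v)) \<circ> inv_chart c))"

definition dual_field ::
  "('m, 'e::euclidean_space) chart set \<Rightarrow> ('m \<Rightarrow> 'e \<Rightarrow> 'e \<Rightarrow> real) \<Rightarrow> ('m \<Rightarrow> 'e \<Rightarrow> real) \<Rightarrow>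
    ('m \<Rightarrow> 'e) \<Rightarrow> bool" where
  "dual_field A \<alpha> \<beta> B \<longleftrightarrow> vector_field A B \<and>
     (\<forall>Y. vector_field A Y \<longrightarrow> (\<forall>p. \<alpha> p (B p) (Y p) = \<beta> p (Y p)))"

definition dir_deriv ::
  "('m, 'e::euclidean_space) chart set \<Rightarrow> ('m \<Rightarrow> 'e) \<Rightarrow> ('m \<Rightarrow> real) \<Rightarrow> 'm \<Rightarrow> real" where
  "dir_deriv A X f p =
     (let c = chart_at A p in frechet_derivative (f \<circ> inv_chart c) (at (map_chart c p)) (X p))"

text \<open>In local coordinates \<open>[X, Y]\<^sup>k = X\<^sup>i \<partial>\<^sub>i Y\<^sup>k - Y\<^sup>i \<partial>\<^sub>i X\<^sup>k\<close>.\<close>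

definition lie_bracket ::
  "('m, 'e::euclidean_space) chart set \<Rightarrow> ('m \<Rightarrow> 'e) \<Rightarrow> ('m \<Rightarrow> 'e) \<Rightarrow> 'm \<Rightarrow> 'e" where
  "lie_bracket A X Y p =
     (let c = chart_at A p in
        frechet_derivative (field_in_chart A c Y) (at (map_chart c p)) (X p) -
        frechet_derivative (field_in_chart A c X) (at (map_chart c p)) (Y p))"

definition ext_deriv ::
  "('m, 'e::euclidean_space) chart set \<Rightarrow> ('m \<Rightarrow> 'e \<Rightarrow> real) \<Rightarrow>
    ('m \<Rightarrow> 'e) \<Rightarrow> ('m \<Rightarrow> 'e) \<Rightarrow> 'm \<Rightarrow> real" where
  "ext_deriv A \<beta> X Y p =
     dir_deriv A X (\<lambda>q. \<beta> q (Y q)) p - dir_deriv A Y (\<lambda>q. \<beta> q (X q)) p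
     - \<beta> p (lie_bracket A X Y p)"


section \<open>Linear connections\<close>

type_synonym ('m, 'e) connection = "('m \<Rightarrow> 'e) \<Rightarrow> ('m \<Rightarrow> 'e) \<Rightarrow> 'm \<Rightarrow> 'e"

definition linear_connection ::
  "('m, 'e::euclidean_space) chart set \<Rightarrow> ('m, 'e) connection \<Rightarrow> bool" where
  "linear_connection A D \<longleftrightarrow>
     (\<forall>X Y. vector_field A X \<longrightarrow> vector_field A Y \<longrightarrow> vector_field A (D X Y)) \<and>
     (\<forall>X X' Y. vector_field A X \<longrightarrow> vector_field A X' \<longrightarrow> vector_field A Y \<longrightarrow>
        D (\<lambda>p. X p + X' p) Y = (\<lambda>p. D X Y p + D X' Y p)) \<and>
     (\<forall>f X Y. smooth_function A f \<longrightarrow> vector_field A X \<longrightarrow> vector_field A Y \<longrightarrow>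
        D (\<lambda>p. f p *\<^sub>R X p) Y = (\<lambda>p. f p *\<^sub>R D X Y p)) \<and>
     (\<forall>X Y Y'. vector_field A X \<longrightarrow> vector_field A Y \<longrightarrow> vector_field A Y' \<longrightarrow>
        D X (\<lambda>p. Y p + Y' p) = (\<lambda>p. D X Y p + D X Y' p)) \<and>
     (\<forall>f X Y. smooth_function A f \<longrightarrow> vector_field A X \<longrightarrow> vector_field A Y \<longrightarrow>
        D X (\<lambda>p. f p *\<^sub>R Y p) = (\<lambda>p. dir_deriv A X f p *\<^sub>R Y p + f p *\<^sub>R D X Y p))"

definition torsion ::
  "('m, 'e::euclidean_space) chart set \<Rightarrow> ('m, 'e) connection \<Rightarrow>
    ('m \<Rightarrow> 'e) \<Rightarrow> ('m \<Rightarrow> 'e) \<Rightarrow> 'm \<Rightarrow> 'e" where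
  "torsion A D X Y p = D X Y p - D Y X p - lie_bracket A X Y p"

definition levi_civita ::
  "('m, 'e::euclidean_space) chart set \<Rightarrow> ('m \<Rightarrow> 'e \<Rightarrow> 'e \<Rightarrow> real) \<Rightarrow>
    ('m, 'e) connection \<Rightarrow> bool" where
  "levi_civita A \<alpha> D \<longleftrightarrow> linear_connection A D \<and>
     (\<forall>X Y p. vector_field A X \<longrightarrow> vector_field A Y \<longrightarrow> torsion A D X Y p = 0) \<and>
     (\<forall>X Y Z p. vector_field A X \<longrightarrow> vector_field A Y \<longrightarrow> vector_field A Z \<longrightarrow>
        dir_deriv A X (\<lambda>q. \<alpha> q (Y q) (Z q)) p = \<alpha> p (D X Y p) (Z p) + \<alpha> p (Y p) (D X Z p))"


section \<open>Parallel transport\<close>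

definition smooth_curve ::
  "('m::topological_space, 'e::euclidean_space) chart set \<Rightarrow> real set \<Rightarrow> (real \<Rightarrow> 'm) \<Rightarrow> bool" where
  "smooth_curve A I \<gamma> \<longleftrightarrow> continuous_on I \<gamma> \<and>
     (\<forall>c\<in>A. smooth_on {t\<in>I. \<gamma> t \<in> dom_chart c} (map_chart c \<circ> \<gamma>))"

definition velocity ::
  "('m, 'e::euclidean_space) chart set \<Rightarrow> (real \<Rightarrow> 'm) \<Rightarrow> real \<Rightarrow> 'e" where
  "velocity A \<gamma> t = vector_derivative (map_chart (chart_at A (\<gamma> t)) \<circ> \<gamma>) (at t)"

definition smooth_field_along ::
  "('m, 'e::euclidean_space) chart set \<Rightarrow> real set \<Rightarrow> (real \<Rightarrow> 'm) \<Rightarrow> (real \<Rightarrow> 'e) \<Rightarrow> bool" where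
  "smooth_field_along A I \<gamma> V \<longleftrightarrow>
     (\<forall>c\<in>A. smooth_on {t\<in>I. \<gamma> t \<in> dom_chart c} (\<lambda>t. to_chart A c (\<gamma> t) (V t)))"

text \<open>The covariant derivative along a curve is the operator that is additive, satisfies the
  Leibniz rule and takes the value \<open>D X Y\<close> at \<open>\<gamma> t\<close>, where \<open>X\<close> extends the velocity, on a
  restriction \<open>Y \<circ> \<gamma>\<close>. Since any smooth field along \<open>\<gamma>\<close> is near \<open>t\<close> a combination, with
  time-dependent coefficients, of vector fields of the manifold (extend a local frame), these
  rules determine its value \<open>w\<close> at \<open>t\<close>.\<close>

definition has_cov_deriv_along ::
  "('m, 'e::euclidean_space) chart set \<Rightarrow> ('m, 'e) connection \<Rightarrow>
    (real \<Rightarrow> 'm) \<Rightarrow> (real \<Rightarrow> 'e) \<Rightarrow> real \<Rightarrow> 'e \<Rightarrow> bool" where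
  "has_cov_deriv_along A D \<gamma> V t w \<longleftrightarrow>
     (\<exists>(n::nat) (f :: nat \<Rightarrow> real \<Rightarrow> real) (Y :: nat \<Rightarrow> 'm \<Rightarrow> 'e) X.
        (\<forall>i<n. f i differentiable (at t) \<and> vector_field A (Y i)) \<and>
        vector_field A X \<and> X (\<gamma> t) = velocity A \<gamma> t \<and>
        (\<forall>\<^sub>F s in nhds t. V s = (\<Sum>i<n. f i s *\<^sub>R Y i (\<gamma> s))) \<and>
        w = (\<Sum>i<n. vector_derivative (f i) (at t) *\<^sub>R Y i (\<gamma> t) + f i t *\<^sub>R D X (Y i) (\<gamma> t)))"

definition parallel_along ::
  "('m, 'e::euclidean_space) chart set \<Rightarrow> ('m, 'e) connection \<Rightarrow>
    real set \<Rightarrow> (real \<Rightarrow> 'm) \<Rightarrow> (real \<Rightarrow> 'e) \<Rightarrow> bool" where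
  "parallel_along A D I \<gamma> V \<longleftrightarrow>
     smooth_field_along A I \<gamma> V \<and> (\<forall>t\<in>I. has_cov_deriv_along A D \<gamma> V t 0)"

text \<open>The graph of the parallel transport along \<open>\<gamma>\<close> from \<open>\<gamma> s\<close> to \<open>\<gamma> t\<close>.\<close>

definition parallel_transport ::
  "('m, 'e::euclidean_space) chart set \<Rightarrow> ('m, 'e) connection \<Rightarrow>
    real set \<Rightarrow> (real \<Rightarrow> 'm) \<Rightarrow> real \<Rightarrow> real \<Rightarrow> 'e \<Rightarrow> 'e \<Rightarrow> bool" where
  "parallel_transport A D I \<gamma> s t v w \<longleftrightarrow> (\<exists>V. parallel_along A D I \<gamma> V \<and> V s = v \<and> V t = w)"

text \<open>Curves are parametrized by open intervals; a smooth curve on a compact interval is the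
  restriction of one of these.\<close>

definition compatible ::
  "('m::topological_space, 'e::euclidean_space) chart set \<Rightarrow> ('m \<Rightarrow> 'e \<Rightarrow> real) \<Rightarrow>
    ('m, 'e) connection \<Rightarrow> bool" where
  "compatible A F D \<longleftrightarrow>
     (\<forall>a b \<gamma> s t v w. smooth_curve A {a<..<b} \<gamma> \<longrightarrow> s \<in> {a<..<b} \<longrightarrow> t \<in> {a<..<b} \<longrightarrow>
        parallel_transport A D {a<..<b} \<gamma> s t v w \<longrightarrow> F (\<gamma> t) w = F (\<gamma> s) v)"


section \<open>Randers metrics and extremal compatible connections\<close>

definition randers :: "('m \<Rightarrow> 'e \<Rightarrow> 'e \<Rightarrow> real) \<Rightarrow> ('m \<Rightarrow> 'e \<Rightarrow> real) \<Rightarrow> 'm \<Rightarrow> 'e \<Rightarrow> real" where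
  "randers \<alpha> \<beta> p v = sqrt (\<alpha> p v v) + \<beta> p v"

definition generalized_berwald ::
  "('m::topological_space, 'e::euclidean_space) chart set \<Rightarrow> ('m \<Rightarrow> 'e \<Rightarrow> real) \<Rightarrow> bool" where
  "generalized_berwald A F \<longleftrightarrow> (\<exists>D. linear_connection A D \<and> compatible A F D)"

definition extend_vector ::
  "('m, 'e::euclidean_space) chart set \<Rightarrow> 'm \<Rightarrow> 'e \<Rightarrow> 'm \<Rightarrow> 'e" where
  "extend_vector A p v = (SOME X. vector_field A X \<and> X p = v)"

text \<open>The torsion tensor on tangent vectors at \<open>p\<close>; by tensoriality the choice of the extensions
  is immaterial.\<close>

definition torsion_at ::
  "('m, 'e::euclidean_space) chart set \<Rightarrow> ('m, 'e) connection \<Rightarrow> 'm \<Rightarrow> 'e \<Rightarrow> 'e \<Rightarrow> 'e" where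
  "torsion_at A D p u v = torsion A D (extend_vector A p u) (extend_vector A p v) p"

definition orthonormal_basis ::
  "('m \<Rightarrow> 'e \<Rightarrow> 'e \<Rightarrow> real) \<Rightarrow> 'm \<Rightarrow> 'e::euclidean_space set \<Rightarrow> bool" where
  "orthonormal_basis \<alpha> p E \<longleftrightarrow> independent E \<and> span E = UNIV \<and>
     (\<forall>u\<in>E. \<forall>v\<in>E. \<alpha> p u v = (if u = v then 1 else 0))"

text \<open>The sum of the squares does not depend on the chosen orthonormal basis.\<close>

definition torsion_norm_sq ::
  "('m, 'e::euclidean_space) chart set \<Rightarrow> ('m \<Rightarrow> 'e \<Rightarrow> 'e \<Rightarrow> real) \<Rightarrow>
    ('m, 'e) connection \<Rightarrow> 'm \<Rightarrow> real" where
  "torsion_norm_sq A \<alpha> D p =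
     (let E = (SOME E. orthonormal_basis \<alpha> p E) in
        \<Sum>u\<in>E. \<Sum>v\<in>E. \<Sum>w\<in>E. (representation E (torsion_at A D p u v) w)\<^sup>2)"

definition extremal_compatible_connection ::
  "('m::topological_space, 'e::euclidean_space) chart set \<Rightarrow> ('m \<Rightarrow> 'e \<Rightarrow> 'e \<Rightarrow> real) \<Rightarrow>
    ('m \<Rightarrow> 'e \<Rightarrow> real) \<Rightarrow> ('m, 'e) connection \<Rightarrow> bool" where
  "extremal_compatible_connection A \<alpha> F D \<longleftrightarrow> linear_connection A D \<and> compatible A F D \<and>
     (\<forall>D'. linear_connection A D' \<longrightarrow> compatible A F D' \<longrightarrow>
        (\<forall>p. torsion_norm_sq A \<alpha> D p \<le> torsion_norm_sq A \<alpha> D' p))"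

text \<open>\<open>N\<close> is the Levi-Civita connection of \<open>\<alpha>\<close> and \<open>B\<close> the vector field dual to \<open>\<beta>\<close>.\<close>

definition T_circ ::
  "('m \<Rightarrow> 'e \<Rightarrow> 'e \<Rightarrow> real) \<Rightarrow> ('m \<Rightarrow> 'e) \<Rightarrow> ('m, 'e) connection \<Rightarrow> real \<Rightarrow>
    ('m \<Rightarrow> 'e) \<Rightarrow> ('m \<Rightarrow> 'e) \<Rightarrow> 'm \<Rightarrow> 'e::euclidean_space" where
  "T_circ \<alpha> B N K X Y p =
     (\<alpha> p (N X B p) (Y p) / K\<^sup>2) *\<^sub>R B p - (\<alpha> p (Y p) (B p) / K\<^sup>2) *\<^sub>R N X B p
     - (\<alpha> p (N Y B p) (X p) / K\<^sup>2) *\<^sub>R B p + (\<alpha> p (X p) (B p) / K\<^sup>2) *\<^sub>R N Y B p"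

end

theory Submission
  imports Defs
begin

text \<open>A linear connection is compatible with \<open>F\<close> if and only if both \<open>\<alpha>\<close> and \<open>\<beta>\<close> are parallel: along a
  parallel field \<open>V\<close>, constancy of \<open>F(V)\<close> and \<open>F(-V)\<close> means that \<open>\<alpha>(V,V)\<close> and \<open>\<beta>(V)\<close> are
  constant. If \<open>D\<close> is compatible and \<open>U\<close>, \<open>V\<close>, \<open>W\<close> are vector fields with \<open>V\<close>, \<open>W\<close> orthogonal to
  \<open>B = \<beta>\<^sup>\<sharp>\<close>, then \<open>D + r S\<close> with \<open>S(X,Y) = \<alpha>(X,U) (\<alpha>(Y,V) W - \<alpha>(Y,W) V)\<close> is
  compatible for every real \<open>r\<close>. Hence, by the first variation of \<open>|T|\<^sup>2\<close>, the extremal torsion satisfies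
  \<open>\<alpha>(T(U,V),W) = \<alpha>(T(U,W),V)\<close> whenever \<open>V\<close> and \<open>W\<close> are orthogonal to \<open>B\<close>, and together with
  \<open>D \<alpha> = 0\<close> and \<open>D B = 0\<close> this determines the difference from the Levi-Civita connection.\<close>

section \<open>Calculus of smooth maps\<close>

text \<open>Compatibility speaks only of parallel fields along curves. To extract from it that
  \<alpha> and \<beta> are parallel, a parallel field with arbitrary velocity and arbitrary value at
  a point must exist; this is why a linear differential equation is solved. A short interval
  suffices, because only the derivative at time 0 is taken. Minimality compares global connections
  although it is exploited at one point: U, V and W are global extensions of tangent vectors,
  obtained from cut-offs, and V, W are made orthogonal to B everywhere by subtracting \<alpha>(Y, B)
  B / K^2, where K^2 = \<alpha>(B, B) is a nonzero constant. For H = D - N, with N the Levi-Civita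
  connection, D B = 0 reads H(u, B) = - N_u B, and skewness fixes all components of H with B in the
  second or third place. Inserting U = B in the symmetry shows that H(B, _) on the complement of B
  is, up to sign, half of d\<beta>: this is the origin of the factors 1/2. Removing the projections
  from that component turns 1 / K^2 into 1 / K^4 in the last term.\<close>

lemma frechet_derivative_cong_open:
  assumes "open S" "x \<in> S" "\<And>y. y \<in> S \<Longrightarrow> f y = g y"
  shows "frechet_derivative f (at x) = frechet_derivative g (at x)"
proof -
  have "(f has_derivative f') (at x) \<longleftrightarrow> (g has_derivative f') (at x)" for f'
    using has_derivative_transform_within_open[of f f' x UNIV S g]
      has_derivative_transform_within_open[of g f' x UNIV S f] assms by auto
  then show ?thesis by (simp add: frechet_derivative_def)
qed

lemma differentiable_cong_open:
  assumes "open S" "x \<in> S" "\<And>y. y \<in> S \<Longrightarrow> f y = g y" "f differentiable (at x)"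
  shows "g differentiable (at x)"
  using assms has_derivative_transform_within_open[of f _ x UNIV S g]
  unfolding differentiable_def by blast

lemma Ck_on_cong:
  assumes "open S" "\<And>y. y \<in> S \<Longrightarrow> f y = g y" "Ck_on k S f"
  shows "Ck_on k S g"
  using assms(2,3)
proof (induction k arbitrary: f g)
  case 0
  then show ?case using continuous_on_cong[of S S f g] by auto
next
  case (Suc k)
  have d: "g differentiable (at x)" if "x \<in> S" for x
    using differentiable_cong_open[OF assms(1) that, of f g] Suc.prems that by auto
  have "Ck_on k S (\<lambda>x. frechet_derivative g (at x) v)" for v
  proof (rule Suc.IH)
    show "Ck_on k S (\<lambda>x. frechet_derivative f (at x) v)" using Suc.prems by auto
    show "frechet_derivative f (at y) v = frechet_derivative g (at y) v" if "y \<in> S" for y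
      using frechet_derivative_cong_open[OF assms(1) that, of f g] Suc.prems(1) by metis
  qed
  with d show ?case by auto
qed

lemma Ck_on_subset: "Ck_on k S f \<Longrightarrow> T \<subseteq> S \<Longrightarrow> Ck_on k T f"
proof (induction k arbitrary: f)
  case 0
  then show ?case by (auto intro: continuous_on_subset)
qed auto

lemma Ck_on_Suc_imp: "Ck_on (Suc k) S f \<Longrightarrow> Ck_on k S f"
proof (induction k arbitrary: f)
  case 0
  then have "\<And>x. x \<in> S \<Longrightarrow> f differentiable (at x)" by simp
  then show ?case
    using differentiable_imp_continuous_within continuous_at_imp_continuous_on
    unfolding Ck_on.simps(1) by blast
next
  case (Suc k)
  show ?case using Suc.prems Suc.IH by (metis Ck_on.simps(2))
qed

lemma Ck_on_local:
  assumes "\<And>x. x \<in> S \<Longrightarrow> \<exists>U. open U \<and> x \<in> U \<and> Ck_on k U f"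
  shows "Ck_on k S f"
  using assms
proof (induction k arbitrary: f)
  case 0
  then show ?case
    by (metis Ck_on.simps(1) continuous_at_imp_continuous_on continuous_on_eq_continuous_at)
next
  case (Suc k)
  have "Ck_on k S (\<lambda>x. frechet_derivative f (at x) v)" for v
    by (rule Suc.IH) (use Suc.prems in fastforce)
  then show ?case using Suc.prems by fastforce
qed

lemma Ck_on_const [simp]: "Ck_on k S (\<lambda>x. c)"
  by (induction k arbitrary: c) auto

text \<open>Derivatives at a point are unique, so any explicit formula may replace
  \<open>frechet_derivative\<close>. The inductive steps below all use this form.\<close>

lemma Ck_on_SucI:
  assumes "open S" "\<And>x. x \<in> S \<Longrightarrow> (f has_derivative f' x) (at x)"
    "\<And>v. Ck_on k S (\<lambda>x. f' x v)"
  shows "Ck_on (Suc k) S f"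
proof -
  have "Ck_on k S (\<lambda>x. frechet_derivative f (at x) v)" for v
    by (rule Ck_on_cong[OF assms(1) _ assms(3)[of v]])
      (use assms(2) frechet_derivative_at in metis)
  then show ?thesis using assms(2) by (auto simp: differentiable_def)
qed

lemma Ck_on_SucD:
  assumes "Ck_on (Suc k) S f" "x \<in> S"
  shows "(f has_derivative frechet_derivative f (at x)) (at x)"
  using assms frechet_derivative_works by auto

lemma Ck_on_bounded_linear:
  assumes "bounded_linear h" "open S" "Ck_on k S f"
  shows "Ck_on k S (\<lambda>x. h (f x))"
  using assms(3)
proof (induction k arbitrary: f)
  case 0
  then show ?case
    using assms(1) by (auto intro: bounded_linear.continuous_on)
next
  case (Suc k)
  show ?case
  proof (rule Ck_on_SucI[OF assms(2)])
    show "((\<lambda>x. h (f x)) has_derivative (\<lambda>v. h (frechet_derivative f (at x) v))) (at x)"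
      if "x \<in> S" for x
      using bounded_linear.has_derivative[OF assms(1) Ck_on_SucD[OF Suc.prems that]] .
    show "Ck_on k S (\<lambda>x. h (frechet_derivative f (at x) v))" for v
      by (rule Suc.IH) (use Suc.prems in auto)
  qed
qed

lemma Ck_on_add:
  assumes "open S" "Ck_on k S f" "Ck_on k S g"
  shows "Ck_on k S (\<lambda>x. f x + g x)"
  using assms(2,3)
proof (induction k arbitrary: f g)
  case 0
  then show ?case by (auto intro: continuous_on_add)
next
  case (Suc k)
  show ?case
  proof (rule Ck_on_SucI[OF assms(1)])
    show "((\<lambda>x. f x + g x) has_derivative
        (\<lambda>v. frechet_derivative f (at x) v + frechet_derivative g (at x) v)) (at x)"
      if "x \<in> S" for x
      using has_derivative_add[OF Ck_on_SucD[OF Suc.prems(1) that] Ck_on_SucD[OF Suc.prems(2) that]] .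
    show "Ck_on k S (\<lambda>x. frechet_derivative f (at x) v + frechet_derivative g (at x) v)" for v
      by (rule Suc.IH) (use Suc.prems in auto)
  qed
qed

lemma Ck_on_sum:
  assumes "open S" "\<And>i. i \<in> I \<Longrightarrow> Ck_on k S (f i)"
  shows "Ck_on k S (\<lambda>x. \<Sum>i\<in>I. f i x)"
proof (cases "finite I")
  case True
  then show ?thesis using assms(2)
    by (induction I) (auto intro: Ck_on_add[OF assms(1)])
qed auto

lemma Ck_on_bilinear:
  assumes "bounded_bilinear h" "open S" "Ck_on k S f" "Ck_on k S g"
  shows "Ck_on k S (\<lambda>x. h (f x) (g x))"
  using assms(3,4)
proof (induction k arbitrary: f g)
  case 0
  then show ?case
    using assms(1) by (auto intro: bounded_bilinear.continuous_on)
next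
  case (Suc k)
  show ?case
  proof (rule Ck_on_SucI[OF assms(2)])
    show "((\<lambda>x. h (f x) (g x)) has_derivative
        (\<lambda>v. h (f x) (frechet_derivative g (at x) v) + h (frechet_derivative f (at x) v) (g x))) (at x)"
      if "x \<in> S" for x
      using bounded_bilinear.FDERIV[OF assms(1) Ck_on_SucD[OF Suc.prems(1) that]
          Ck_on_SucD[OF Suc.prems(2) that]] .
    show "Ck_on k S (\<lambda>x. h (f x) (frechet_derivative g (at x) v)
        + h (frechet_derivative f (at x) v) (g x))" for v
      by (intro Ck_on_add[OF assms(2)] Suc.IH)
        (use Suc.prems Ck_on_Suc_imp in auto)
  qed
qed

lemma linear_Basis_sum:
  fixes h :: "'a::euclidean_space \<Rightarrow> 'b::real_vector"
  assumes "linear h"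
  shows "h w = (\<Sum>b\<in>Basis. (w \<bullet> b) *\<^sub>R h b)"
proof -
  have "h w = h (\<Sum>b\<in>Basis. (w \<bullet> b) *\<^sub>R b)" by (simp only: euclidean_representation)
  then show ?thesis by (simp only: linear_sum[OF assms] linear_scale[OF assms])
qed

text \<open>\<open>Ck_on\<close> differentiates in fixed directions only, whereas the chain rule
  differentiates g in the direction of the derivative of f, which moves with x. Expanding that
  direction over \<open>Basis\<close> leaves fixed directions with scalar coefficients, and the
  induction hypothesis applies to each directional derivative of g composed with the same f.\<close>

lemma Ck_on_compose:
  fixes f :: "'a::real_normed_vector \<Rightarrow> 'b::euclidean_space"
    and g :: "'b \<Rightarrow> 'c::real_normed_vector"
  assumes "open S" "open T" "f ` S \<subseteq> T" "Ck_on k S f" "Ck_on k T g"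
  shows "Ck_on k S (\<lambda>x. g (f x))"
  using assms(4,5)
proof (induction k arbitrary: g)
  case 0
  then show ?case
    using assms(3) by (auto intro: continuous_on_compose2)
next
  case (Suc k)
  have ch: "((\<lambda>x. g (f x)) has_derivative (\<lambda>v. \<Sum>b\<in>Basis.
        (frechet_derivative f (at x) v \<bullet> b) *\<^sub>R frechet_derivative g (at (f x)) b)) (at x)"
    if "x \<in> S" for x
  proof -
    have dg: "(g has_derivative frechet_derivative g (at (f x))) (at (f x))"
      using Ck_on_SucD[OF Suc.prems(2)] that assms(3) by blast
    have "((\<lambda>x. g (f x)) has_derivative
        (\<lambda>v. frechet_derivative g (at (f x)) (frechet_derivative f (at x) v))) (at x)"
      using has_derivative_compose[OF Ck_on_SucD[OF Suc.prems(1) that] dg] .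
    then show ?thesis
      by (rule has_derivative_eq_rhs)
        (intro ext linear_Basis_sum has_derivative_linear[OF dg])
  qed
  show ?case
  proof (rule Ck_on_SucI[OF assms(1) ch])
    fix v
    have "Ck_on k S (\<lambda>x. (frechet_derivative f (at x) v \<bullet> b) *\<^sub>R frechet_derivative g (at (f x)) b)"
      for b
    proof (intro Ck_on_bilinear[OF bounded_bilinear_scaleR assms(1)])
      show "Ck_on k S (\<lambda>x. frechet_derivative f (at x) v \<bullet> b)"
        by (rule Ck_on_bounded_linear[OF bounded_linear_inner_left assms(1)])
          (use Suc.prems in auto)
      show "Ck_on k S (\<lambda>x. frechet_derivative g (at (f x)) b)"
        using Suc.IH[of "\<lambda>y. frechet_derivative g (at y) b"] Suc.prems Ck_on_Suc_imp by auto
    qed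
    then show "Ck_on k S (\<lambda>x. \<Sum>b\<in>Basis.
        (frechet_derivative f (at x) v \<bullet> b) *\<^sub>R frechet_derivative g (at (f x)) b)"
      by (intro Ck_on_sum[OF assms(1)])
  qed
qed

text \<open>The derivative of 1/f contains 1/f twice, but one order of smoothness lower, where the
  induction hypothesis supplies it.\<close>

lemma Ck_on_inverse:
  fixes f :: "'a::real_normed_vector \<Rightarrow> real"
  assumes "open S" "\<And>x. x \<in> S \<Longrightarrow> f x \<noteq> 0" "Ck_on k S f"
  shows "Ck_on k S (\<lambda>x. inverse (f x))"
  using assms(3)
proof (induction k)
  case 0
  then show ?case using assms(2) by (auto intro: continuous_on_inverse)
next
  case (Suc k)
  show ?case
  proof (rule Ck_on_SucI[OF assms(1)])
    show "((\<lambda>x. inverse (f x)) has_derivative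
        (\<lambda>v. - (inverse (f x) * frechet_derivative f (at x) v * inverse (f x)))) (at x)"
      if "x \<in> S" for x
      using Deriv.has_derivative_inverse[OF assms(2)[OF that] Ck_on_SucD[OF Suc.prems that]] .
    fix v
    have i: "Ck_on k S (\<lambda>x. inverse (f x))" using Suc Ck_on_Suc_imp by blast
    have "Ck_on k S (\<lambda>x. inverse (f x) * frechet_derivative f (at x) v * inverse (f x))"
      by (intro Ck_on_bilinear[OF bounded_bilinear_mult assms(1)] i) (use Suc.prems in auto)
    then show "Ck_on k S (\<lambda>x. - (inverse (f x) * frechet_derivative f (at x) v * inverse (f x)))"
      using Ck_on_bounded_linear[OF bounded_linear_minus[OF bounded_linear_ident] assms(1)] by blast
  qed
qed

lemma Ck_on_vector_derivative:
  assumes "open S" "\<And>t. t \<in> S \<Longrightarrow> (f has_vector_derivative f' t) (at t)" "Ck_on k S f'"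
  shows "Ck_on (Suc k) S f"
proof (rule Ck_on_SucI[OF assms(1)])
  show "(f has_derivative (\<lambda>v. v *\<^sub>R f' t)) (at t)" if "t \<in> S" for t
    using assms(2)[OF that] by (simp add: has_vector_derivative_def)
  show "Ck_on k S (\<lambda>x. v *\<^sub>R f' x)" for v
    by (rule Ck_on_bounded_linear[OF bounded_linear_scaleR_right assms(1,3)])
qed

lemma smooth_on_cong:
  "open S \<Longrightarrow> (\<And>y. y \<in> S \<Longrightarrow> f y = g y) \<Longrightarrow> smooth_on S f \<Longrightarrow> smooth_on S g"
  unfolding smooth_on_def using Ck_on_cong by blast

lemma smooth_on_subset: "smooth_on S f \<Longrightarrow> T \<subseteq> S \<Longrightarrow> smooth_on T f"
  unfolding smooth_on_def using Ck_on_subset by blast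

lemma smooth_on_local:
  assumes "\<And>x. x \<in> S \<Longrightarrow> \<exists>U. open U \<and> x \<in> U \<and> smooth_on U f"
  shows "smooth_on S f"
  unfolding smooth_on_def
proof
  show "Ck_on k S f" for k
    by (rule Ck_on_local) (use assms smooth_on_def in blast)
qed

lemma smooth_on_const [simp]: "smooth_on S (\<lambda>x. c)"
  by (simp add: smooth_on_def)

lemma smooth_on_linear:
  fixes h :: "'b::euclidean_space \<Rightarrow> 'c::real_normed_vector"
  assumes "linear h" "open S" "smooth_on S f"
  shows "smooth_on S (\<lambda>x. h (f x))"
  using assms Ck_on_bounded_linear[of h] linear_conv_bounded_linear[of h]
  by (auto simp: smooth_on_def)

lemma smooth_on_id: "open S \<Longrightarrow> smooth_on S (\<lambda>x. x)"
  unfolding smooth_on_def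
proof
  fix k assume S: "open S"
  show "Ck_on k S (\<lambda>x. x)"
    by (cases k) (auto intro!: continuous_on_id S Ck_on_SucI[where f' = "\<lambda>x v. v"] simp del: Ck_on.simps(2))
qed

lemma smooth_on_add:
  "open S \<Longrightarrow> smooth_on S f \<Longrightarrow> smooth_on S g \<Longrightarrow> smooth_on S (\<lambda>x. f x + g x)"
  by (simp add: smooth_on_def Ck_on_add)

lemma smooth_on_sum:
  "open S \<Longrightarrow> (\<And>i. i \<in> I \<Longrightarrow> smooth_on S (f i)) \<Longrightarrow> smooth_on S (\<lambda>x. \<Sum>i\<in>I. f i x)"
  using Ck_on_sum[of S I _ f] by (auto simp: smooth_on_def)

lemma smooth_on_scaleR:
  "open S \<Longrightarrow> smooth_on S f \<Longrightarrow> smooth_on S g \<Longrightarrow> smooth_on S (\<lambda>x. f x *\<^sub>R g x)"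
  by (simp add: smooth_on_def Ck_on_bilinear[OF bounded_bilinear_scaleR])

lemma smooth_on_mult:
  fixes f g :: "'a::real_normed_vector \<Rightarrow> real"
  shows "open S \<Longrightarrow> smooth_on S f \<Longrightarrow> smooth_on S g \<Longrightarrow> smooth_on S (\<lambda>x. f x * g x)"
  by (simp add: smooth_on_def Ck_on_bilinear[OF bounded_bilinear_mult])

lemma smooth_on_inner:
  "open S \<Longrightarrow> smooth_on S f \<Longrightarrow> smooth_on S g \<Longrightarrow> smooth_on S (\<lambda>x. f x \<bullet> g x)"
  by (simp add: smooth_on_def Ck_on_bilinear[OF bounded_bilinear_inner])

lemma smooth_on_inverse:
  fixes f :: "'a::real_normed_vector \<Rightarrow> real"
  shows "open S \<Longrightarrow> (\<And>x. x \<in> S \<Longrightarrow> f x \<noteq> 0) \<Longrightarrow> smooth_on S f \<Longrightarrow> smooth_on S (\<lambda>x. inverse (f x))"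
  by (simp add: smooth_on_def Ck_on_inverse)

lemma smooth_on_compose:
  fixes f :: "'a::real_normed_vector \<Rightarrow> 'b::euclidean_space"
    and g :: "'b \<Rightarrow> 'c::real_normed_vector"
  shows "open S \<Longrightarrow> open T \<Longrightarrow> f ` S \<subseteq> T \<Longrightarrow> smooth_on S f \<Longrightarrow> smooth_on T g
    \<Longrightarrow> smooth_on S (\<lambda>x. g (f x))"
  using Ck_on_compose[of S T f _ g] by (auto simp: smooth_on_def)

lemma smooth_on_differentiable: "smooth_on S f \<Longrightarrow> x \<in> S \<Longrightarrow> f differentiable (at x)"
  unfolding smooth_on_def by (metis Ck_on.simps(2))

lemma smooth_on_has_derivative:
  "smooth_on S f \<Longrightarrow> x \<in> S \<Longrightarrow> (f has_derivative frechet_derivative f (at x)) (at x)"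
  using smooth_on_differentiable frechet_derivative_works by blast

lemma smooth_on_continuous: "smooth_on S f \<Longrightarrow> continuous_on S f"
  unfolding smooth_on_def by (metis Ck_on.simps(1))

lemma smooth_on_frechet_derivative:
  "smooth_on S f \<Longrightarrow> smooth_on S (\<lambda>x. frechet_derivative f (at x) v)"
  unfolding smooth_on_def by (metis Ck_on.simps(2))

text \<open>As in the chain rule, a direction that varies with x is expanded over
  \<open>Basis\<close>.\<close>

lemma smooth_on_frechet_derivative_apply:
  fixes f :: "'a::euclidean_space \<Rightarrow> 'b::real_normed_vector"
  assumes "open S" "smooth_on S f" "smooth_on S g"
  shows "smooth_on S (\<lambda>x. frechet_derivative f (at x) (g x))"
proof -
  have "smooth_on S (\<lambda>x. \<Sum>b\<in>Basis. (g x \<bullet> b) *\<^sub>R frechet_derivative f (at x) b)"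
    by (intro smooth_on_sum smooth_on_scaleR smooth_on_inner assms smooth_on_frechet_derivative) simp
  then show ?thesis
    by (rule smooth_on_cong[OF assms(1), rotated])
      (metis linear_Basis_sum assms(2) linear_frechet_derivative smooth_on_differentiable)
qed

section \<open>Smooth bump functions\<close>

text \<open>The linear span of these functions is closed under differentiation.\<close>

definition flat :: "nat \<Rightarrow> real \<Rightarrow> real" where
  "flat n t = (if t > 0 then inverse t ^ n * exp (- inverse t) else 0)"

lemma flat_tendsto_0: "(flat n \<longlongrightarrow> 0) (at 0)"
proof (rule filterlim_split_at)
  show "(flat n \<longlongrightarrow> 0) (at_left 0)"
    by (rule Lim_transform_eventually[of "\<lambda>_. 0"])
      (auto simp: flat_def eventually_at_filter intro!: always_eventually)
  \<comment> \<open>With s = 1/t this is the decay of s^n / exp s at infinity.\<close>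
  have "((\<lambda>t. inverse t ^ n / exp (inverse t)) \<longlongrightarrow> 0) (at_right (0::real))"
    using filterlim_compose[OF tendsto_power_div_exp_0 filterlim_inverse_at_top_right] .
  then show "(flat n \<longlongrightarrow> 0) (at_right 0)"
    by (rule Lim_transform_eventually)
      (auto simp: flat_def eventually_at_filter exp_minus field_simps intro!: always_eventually)
qed

lemma flat_deriv:
  "(flat n has_vector_derivative (flat (n + 2) t - real n * flat (n + 1) t)) (at t)"
proof -
  consider "t > 0" | "t < 0" | "t = 0" by linarith
  then show ?thesis
  proof cases
    case 1
    \<comment> \<open>For n = 0 the exponent \<open>n - 1\<close> is truncated to 0; the factor
      \<open>real n\<close> makes this harmless.\<close>
    have e: "real n * inverse t ^ n = real n * (inverse t ^ (n - 1) * inverse t)"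
      by (cases n) auto
    have "((\<lambda>t. inverse t ^ n * exp (- inverse t)) has_field_derivative
        (inverse t ^ n * (exp (- inverse t) * (inverse t * inverse t))
          - real n * (inverse t ^ (n - 1) * inverse t) * inverse t * exp (- inverse t))) (at t)"
      using 1 by (auto intro!: derivative_eq_intros simp: algebra_simps power2_eq_square)
    also have "inverse t ^ n * (exp (- inverse t) * (inverse t * inverse t))
          - real n * (inverse t ^ (n - 1) * inverse t) * inverse t * exp (- inverse t) =
        flat (n + 2) t - real n * flat (n + 1) t"
      unfolding e[symmetric] using 1 by (simp add: flat_def algebra_simps)
    finally have "((\<lambda>t. inverse t ^ n * exp (- inverse t)) has_field_derivative
        (flat (n + 2) t - real n * flat (n + 1) t)) (at t)" .
    then show ?thesis
      unfolding has_real_derivative_iff_has_vector_derivative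
      by (rule has_vector_derivative_transform_within_open[where S = "{0<..}"])
        (use 1 in \<open>auto simp: flat_def\<close>)
  next
    case 2
    have "((\<lambda>t. 0) has_vector_derivative (flat (n + 2) t - real n * flat (n + 1) t)) (at t)"
      using 2 by (auto simp: flat_def)
    then show ?thesis
      by (rule has_vector_derivative_transform_within_open[where S = "{..<0}"])
        (use 2 in \<open>auto simp: flat_def\<close>)
  next
    case 3
    \<comment> \<open>The difference quotient of \<open>flat n\<close> at 0 is
      \<open>flat (Suc n)\<close>, which tends to 0.\<close>
    have "((\<lambda>h. (flat n (0 + h) - flat n 0) / h) \<longlongrightarrow> 0) (at 0)"
      by (rule Lim_transform_eventually[OF flat_tendsto_0[of "Suc n"]])
        (auto simp: flat_def eventually_at_filter field_simps intro!: always_eventually)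
    then have "(flat n has_field_derivative 0) (at 0)"
      by (simp add: DERIV_def)
    then show ?thesis
      using 3 by (simp add: flat_def has_real_derivative_iff_has_vector_derivative)
  qed
qed

lemma smooth_on_flat: "smooth_on UNIV (flat n)"
  unfolding smooth_on_def
proof
  show "Ck_on k UNIV (flat n)" for k
  proof (induction k arbitrary: n)
    case 0
    show ?case
      unfolding Ck_on.simps(1)
      by (rule continuous_at_imp_continuous_on)
        (blast intro: has_vector_derivative_continuous[OF flat_deriv])
  next
    case (Suc k)
    have "Ck_on k UNIV (\<lambda>t. flat (n + 2) t + (- real n) * flat (n + 1) t)"
      by (intro Ck_on_add Ck_on_bilinear[OF bounded_bilinear_mult] Suc) auto
    then have "Ck_on k UNIV (\<lambda>t. flat (n + 2) t - real n * flat (n + 1) t)"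
      by simp
    then show ?case
      by (rule Ck_on_vector_derivative[OF open_UNIV flat_deriv])
  qed
qed

text \<open>The squared distance is used because the norm itself is not differentiable at the
  centre; division by the value at the centre normalizes the function.\<close>

lemma smooth_bump:
  fixes x :: "'a::euclidean_space"
  assumes "r > 0"
  obtains h :: "'a \<Rightarrow> real" where "smooth_on UNIV h" "h x = 1" "\<And>y. y \<notin> cball x r \<Longrightarrow> h y = 0"
proof
  define h where "h y = inverse (flat 0 (r\<^sup>2)) * flat 0 (r\<^sup>2 - (y - x) \<bullet> (y - x))" for y
  have *: "smooth_on UNIV (\<lambda>y. y - x)"
    using smooth_on_add[OF open_UNIV smooth_on_id smooth_on_const[of UNIV "- x"]] by simp
  have "smooth_on UNIV (\<lambda>y. r\<^sup>2 + (-1) * ((y - x) \<bullet> (y - x)))"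
    by (intro smooth_on_add smooth_on_mult smooth_on_inner *) auto
  then have "smooth_on UNIV (\<lambda>y. flat 0 (r\<^sup>2 - (y - x) \<bullet> (y - x)))"
    using smooth_on_compose[OF open_UNIV open_UNIV _ _ smooth_on_flat] by fastforce
  then show "smooth_on UNIV h"
    unfolding h_def by (intro smooth_on_mult) auto
  show "h x = 1" using assms by (simp add: h_def flat_def)
  show "h y = 0" if "y \<notin> cball x r" for y
  proof -
    have "r < norm (y - x)" using that by (simp add: dist_norm norm_minus_commute)
    then have "r\<^sup>2 < (norm (y - x))\<^sup>2" using assms by (intro power_strict_mono) auto
    then show ?thesis by (simp add: h_def flat_def power2_norm_eq_inner)
  qed
qed

section \<open>Charts, cut-offs and tensoriality\<close>

locale smooth_manifold =
  fixes A :: "('m::{t2_space,second_countable_topology}, 'e::euclidean_space) chart set"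
  assumes atlas: "smooth_atlas A"
begin

lemma is_chart: "c \<in> A \<Longrightarrow> is_chart c"
  using atlas by (auto simp: smooth_atlas_def)

lemma open_dom: "c \<in> A \<Longrightarrow> open (dom_chart c)"
  and open_range: "c \<in> A \<Longrightarrow> open (range_chart c)"
  and inv_map: "c \<in> A \<Longrightarrow> p \<in> dom_chart c \<Longrightarrow> inv_chart c (map_chart c p) = p"
  and map_inv: "c \<in> A \<Longrightarrow> x \<in> range_chart c \<Longrightarrow> map_chart c (inv_chart c x) = x"
  and map_in_range: "p \<in> dom_chart c \<Longrightarrow> map_chart c p \<in> range_chart c"
  and inv_in_dom: "c \<in> A \<Longrightarrow> x \<in> range_chart c \<Longrightarrow> inv_chart c x \<in> dom_chart c"
  and continuous_inv: "c \<in> A \<Longrightarrow> continuous_on (range_chart c) (inv_chart c)"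
  using is_chart[of c] by (auto simp: is_chart_def homeomorphism_def range_chart_def)

lemma chart_at: "chart_at A p \<in> A" "p \<in> dom_chart (chart_at A p)"
proof -
  have "\<exists>c. c \<in> A \<and> p \<in> dom_chart c"
    using atlas unfolding smooth_atlas_def by blast
  from someI_ex[OF this] show "chart_at A p \<in> A" "p \<in> dom_chart (chart_at A p)"
    by (simp_all add: chart_at_def)
qed

lemma open_map_image:
  assumes "c \<in> A" "open U"
  shows "open (map_chart c ` (dom_chart c \<inter> U))"
proof -
  have "map_chart c ` (dom_chart c \<inter> U) = range_chart c \<inter> inv_chart c -` U"
    using assms(1) by (force simp: inv_map map_inv inv_in_dom map_in_range image_iff)
  then show ?thesis
    using continuous_open_preimage[OF continuous_inv open_range assms(2)] assms(1) by simp
qed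

lemma smooth_transition:
  "c \<in> A \<Longrightarrow> d \<in> A \<Longrightarrow> smooth_on (map_chart c ` (dom_chart c \<inter> dom_chart d)) (transition c d)"
  using atlas by (auto simp: smooth_atlas_def)

lemma transition_map: "c \<in> A \<Longrightarrow> p \<in> dom_chart c \<Longrightarrow> transition c d (map_chart c p) = map_chart d p"
  by (simp add: transition_def inv_map)

lemma transition_has_derivative:
  assumes "c \<in> A" "d \<in> A" "p \<in> dom_chart c" "p \<in> dom_chart d"
  shows "(transition c d has_derivative frechet_derivative (transition c d) (at (map_chart c p)))
    (at (map_chart c p))"
  using smooth_on_has_derivative[OF smooth_transition] assms by auto

text \<open>Chain rule for the cocycle identity of transition maps, which holds only on the triple
  overlap; this set is open, so derivatives at its points agree. With one of the charts equal to
  \<open>chart_at A p\<close> it makes components in different charts consistent.\<close>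

lemma transition_derivative_compose:
  assumes "c \<in> A" "d \<in> A" "e \<in> A" "p \<in> dom_chart c" "p \<in> dom_chart d" "p \<in> dom_chart e"
  shows "frechet_derivative (transition d e) (at (map_chart d p))
      (frechet_derivative (transition c d) (at (map_chart c p)) v) =
    frechet_derivative (transition c e) (at (map_chart c p)) v"
proof -
  let ?U = "map_chart c ` (dom_chart c \<inter> (dom_chart d \<inter> dom_chart e))"
  have "((\<lambda>x. transition d e (transition c d x)) has_derivative
      (\<lambda>v. frechet_derivative (transition d e) (at (map_chart d p))
        (frechet_derivative (transition c d) (at (map_chart c p)) v))) (at (map_chart c p))"
    using has_derivative_compose[OF transition_has_derivative[of c d p]]
      transition_has_derivative[of d e p] assms by (simp add: transition_map)
  then have "(transition c e has_derivative
      (\<lambda>v. frechet_derivative (transition d e) (at (map_chart d p))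
        (frechet_derivative (transition c d) (at (map_chart c p)) v))) (at (map_chart c p))"
    by (rule has_derivative_transform_within_open[where s = ?U])
      (use assms in \<open>auto simp: transition_map intro!: open_map_image open_dom open_Int\<close>)
  from frechet_derivative_at[OF this] show ?thesis by metis
qed

lemma transition_derivative_self:
  assumes "c \<in> A" "p \<in> dom_chart c"
  shows "frechet_derivative (transition c c) (at (map_chart c p)) v = v"
proof -
  have "(transition c c has_derivative (\<lambda>v. v)) (at (map_chart c p))"
    by (rule has_derivative_transform_within_open[OF has_derivative_ident open_range[OF assms(1)]])
      (use assms in \<open>auto simp: map_in_range transition_def map_inv\<close>)
  from frechet_derivative_at[OF this] show ?thesis by metis
qed

lemma to_chart_from_chart:
  assumes "c \<in> A" "d \<in> A" "p \<in> dom_chart c" "p \<in> dom_chart d"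
  shows "to_chart A d p (from_chart A c p v) =
    frechet_derivative (transition c d) (at (map_chart c p)) v"
  unfolding to_chart_def from_chart_def
  by (rule transition_derivative_compose) (use assms chart_at in auto)

lemma to_from_chart [simp]:
  assumes "c \<in> A" "p \<in> dom_chart c"
  shows "to_chart A c p (from_chart A c p v) = v"
  using to_chart_from_chart[of c c p v] transition_derivative_self assms by simp

lemma from_to_chart [simp]:
  assumes "c \<in> A" "p \<in> dom_chart c"
  shows "from_chart A c p (to_chart A c p v) = v"
  unfolding to_chart_def from_chart_def
  by (subst transition_derivative_compose) (use assms chart_at transition_derivative_self in auto)

lemma from_chart_at [simp]: "from_chart A (chart_at A p) p v = v"
  unfolding from_chart_def using chart_at transition_derivative_self by blast

lemma to_chart_at [simp]: "to_chart A (chart_at A p) p v = v"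
  unfolding to_chart_def using chart_at transition_derivative_self by blast

lemma linear_to_chart: "c \<in> A \<Longrightarrow> p \<in> dom_chart c \<Longrightarrow> linear (to_chart A c p)"
  and linear_from_chart: "c \<in> A \<Longrightarrow> p \<in> dom_chart c \<Longrightarrow> linear (from_chart A c p)"
  unfolding to_chart_def from_chart_def
  using transition_has_derivative chart_at has_derivative_linear by blast+

lemma field_in_chart_map:
  "c \<in> A \<Longrightarrow> p \<in> dom_chart c \<Longrightarrow> field_in_chart A c X (map_chart c p) = to_chart A c p (X p)"
  by (simp add: field_in_chart_def inv_map)

lemma field_in_chart_change:
  assumes "c \<in> A" "d \<in> A" "p \<in> dom_chart c" "p \<in> dom_chart d"
  shows "field_in_chart A d X (map_chart d p) =
    frechet_derivative (transition c d) (at (map_chart c p)) (field_in_chart A c X (map_chart c p))"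
  using assms to_chart_from_chart[of c d p "to_chart A c p (X p)"]
  by (simp add: field_in_chart_map)

section \<open>Extension by zero from one chart to the manifold\<close>

lemma smooth_on_compose_transition:
  fixes g :: "'e \<Rightarrow> 'b::real_normed_vector"
  assumes "c \<in> A" "d \<in> A" "smooth_on (map_chart c ` (dom_chart c \<inter> dom_chart d)) g"
  shows "smooth_on (map_chart d ` (dom_chart d \<inter> dom_chart c)) (\<lambda>x. g (transition d c x))"
  by (rule smooth_on_compose[OF _ _ _ _ assms(3)])
    (use assms in \<open>auto simp: transition_map smooth_transition intro!: open_map_image open_dom\<close>)

text \<open>The domain of c and the complement of C are open and cover the manifold. On the first
  set the transition maps carry over smoothness, on the second the function is 0. Closedness of C in
  the whole manifold is what makes this work.\<close>

lemma smooth_function_zero_extension: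
  assumes "c \<in> A" "closed C" "C \<subseteq> dom_chart c" "\<And>q. q \<notin> C \<Longrightarrow> f q = 0"
    "smooth_on (range_chart c) (f \<circ> inv_chart c)"
  shows "smooth_function A f"
  unfolding smooth_function_def
proof (intro ballI smooth_on_local)
  fix d x assume d: "d \<in> A" and "x \<in> range_chart d"
  then obtain q where q: "q \<in> dom_chart d" "x = map_chart d q"
    by (auto simp: range_chart_def)
  show "\<exists>U. open U \<and> x \<in> U \<and> smooth_on U (f \<circ> inv_chart d)"
  proof (cases "q \<in> dom_chart c")
    case True
    let ?U = "map_chart d ` (dom_chart d \<inter> dom_chart c)"
    have U: "open ?U" using d assms(1) by (intro open_map_image open_dom)
    have "smooth_on (map_chart c ` (dom_chart c \<inter> dom_chart d)) (f \<circ> inv_chart c)"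
      by (rule smooth_on_subset[OF assms(5)]) (auto simp: range_chart_def)
    from smooth_on_compose_transition[OF assms(1) d this]
    have "smooth_on ?U (f \<circ> inv_chart d)"
      by (rule smooth_on_cong[OF U, rotated]) (use d assms(1) in \<open>auto simp: transition_map inv_map\<close>)
    then show ?thesis using U q True by blast
  next
    case False
    let ?U = "map_chart d ` (dom_chart d \<inter> - C)"
    have U: "open ?U" using d assms(2) by (intro open_map_image) auto
    have "smooth_on ?U (f \<circ> inv_chart d)"
      by (rule smooth_on_cong[OF U _ smooth_on_const]) (use d assms(4) in \<open>auto simp: inv_map\<close>)
    then show ?thesis using U q False assms(3) by blast
  qed
qed

lemma vector_field_zero_extension:
  assumes "c \<in> A" "closed C" "C \<subseteq> dom_chart c" "\<And>q. q \<notin> C \<Longrightarrow> X q = 0"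
    "smooth_on (range_chart c) (field_in_chart A c X)"
  shows "vector_field A X"
  unfolding vector_field_def
proof (intro ballI smooth_on_local)
  fix d x assume d: "d \<in> A" and "x \<in> range_chart d"
  then obtain q where q: "q \<in> dom_chart d" "x = map_chart d q"
    by (auto simp: range_chart_def)
  show "\<exists>U. open U \<and> x \<in> U \<and> smooth_on U (field_in_chart A d X)"
  proof (cases "q \<in> dom_chart c")
    case True
    let ?U = "map_chart d ` (dom_chart d \<inter> dom_chart c)"
    have U: "open ?U" using d assms(1) by (intro open_map_image open_dom)
    \<comment> \<open>In contrast to functions, components also transform by the derivative of the
      transition map, applied to a vector that varies with the point.\<close>
    have "smooth_on (map_chart c ` (dom_chart c \<inter> dom_chart d))
        (\<lambda>y. frechet_derivative (transition c d) (at y) (field_in_chart A c X y))"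
      by (intro smooth_on_frechet_derivative_apply open_map_image open_dom smooth_transition
          smooth_on_subset[OF assms(5)] assms(1) d) (auto simp: range_chart_def)
    from smooth_on_compose_transition[OF assms(1) d this]
    have "smooth_on ?U (field_in_chart A d X)"
      by (rule smooth_on_cong[OF U, rotated])
        (use d assms(1) in \<open>auto simp: transition_map field_in_chart_change[of c d]\<close>)
    then show ?thesis using U q True by blast
  next
    case False
    let ?U = "map_chart d ` (dom_chart d \<inter> - C)"
    have U: "open ?U" using d assms(2) by (intro open_map_image) auto
    have "smooth_on ?U (field_in_chart A d X)"
      by (rule smooth_on_cong[OF U _ smooth_on_const[of _ 0]])
        (use d assms(4) in \<open>auto simp: field_in_chart_map linear_0 linear_to_chart\<close>)
    then show ?thesis using U q False assms(3) by blast
  qed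
qed

lemma smooth_function_const: "smooth_function A (\<lambda>q. r)"
  by (simp add: smooth_function_def comp_def)

lemma smooth_function_mult:
  "smooth_function A f \<Longrightarrow> smooth_function A g \<Longrightarrow> smooth_function A (\<lambda>q. f q * g q)"
  using open_range by (auto simp: smooth_function_def comp_def intro!: smooth_on_mult)

lemma field_in_chart_comp:
  "x \<in> range_chart c \<Longrightarrow> c \<in> A \<Longrightarrow> field_in_chart A c X x = to_chart A c (inv_chart c x) (X (inv_chart c x))"
  by (simp add: field_in_chart_def)

lemma vector_field_add:
  assumes "vector_field A X" "vector_field A Y"
  shows "vector_field A (\<lambda>q. X q + Y q)"
  unfolding vector_field_def
proof
  fix c assume c: "c \<in> A"
  have "smooth_on (range_chart c) (\<lambda>x. field_in_chart A c X x + field_in_chart A c Y x)"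
    using assms c by (intro smooth_on_add open_range) (auto simp: vector_field_def)
  then show "smooth_on (range_chart c) (field_in_chart A c (\<lambda>q. X q + Y q))"
    by (rule smooth_on_cong[OF open_range[OF c], rotated])
      (simp add: field_in_chart_comp c linear_add[OF linear_to_chart] inv_in_dom)
qed

lemma vector_field_scale:
  assumes "smooth_function A f" "vector_field A X"
  shows "vector_field A (\<lambda>q. f q *\<^sub>R X q)"
  unfolding vector_field_def
proof
  fix c assume c: "c \<in> A"
  have "smooth_on (range_chart c) (\<lambda>x. (f \<circ> inv_chart c) x *\<^sub>R field_in_chart A c X x)"
    using assms c by (intro smooth_on_scaleR open_range) (auto simp: vector_field_def smooth_function_def comp_def)
  then show "smooth_on (range_chart c) (field_in_chart A c (\<lambda>q. f q *\<^sub>R X q))"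
    by (rule smooth_on_cong[OF open_range[OF c], rotated])
      (simp add: field_in_chart_comp c linear_scale[OF linear_to_chart] inv_in_dom)
qed

lemma vector_field_cmult: "vector_field A X \<Longrightarrow> vector_field A (\<lambda>q. r *\<^sub>R X q)"
  using vector_field_scale[OF smooth_function_const] .

lemma vector_field_zero: "vector_field A (\<lambda>q. 0)"
  unfolding vector_field_def
proof
  fix c assume c: "c \<in> A"
  show "smooth_on (range_chart c) (field_in_chart A c (\<lambda>q. 0))"
    by (rule smooth_on_cong[OF open_range[OF c] _ smooth_on_const[of _ 0]])
      (simp add: field_in_chart_comp c linear_0[OF linear_to_chart] inv_in_dom)
qed

lemma vector_field_sum:
  "(\<And>i. i \<in> I \<Longrightarrow> vector_field A (X i)) \<Longrightarrow> vector_field A (\<lambda>q. \<Sum>i\<in>I. X i q)"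
  by (induction I rule: infinite_finite_induct) (auto intro: vector_field_add vector_field_zero)

section \<open>Cut-off functions and global frames\<close>

definition cutoff :: "('m, 'e) chart \<Rightarrow> ('m \<Rightarrow> real) \<Rightarrow> bool" where
  "cutoff c \<psi> \<longleftrightarrow> c \<in> A \<and> smooth_function A \<psi> \<and>
     (\<exists>C. closed C \<and> C \<subseteq> dom_chart c \<and> (\<forall>q. q \<notin> C \<longrightarrow> \<psi> q = 0))"

text \<open>For v in \<open>Basis\<close> these are the coordinate fields of c made global by
  \<psi>; they form a frame wherever \<psi> is nonzero. The components of a field need a second
  factor \<psi>, in \<open>cutoff_coeff\<close>, to become global functions.\<close>

definition cutoff_const :: "('m, 'e) chart \<Rightarrow> ('m \<Rightarrow> real) \<Rightarrow> 'e \<Rightarrow> 'm \<Rightarrow> 'e" where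
  "cutoff_const c \<psi> v q = (if q \<in> dom_chart c then \<psi> q *\<^sub>R from_chart A c q v else 0)"

definition cutoff_coeff :: "('m, 'e) chart \<Rightarrow> ('m \<Rightarrow> real) \<Rightarrow> ('m \<Rightarrow> 'e) \<Rightarrow> 'e \<Rightarrow> 'm \<Rightarrow> real" where
  "cutoff_coeff c \<psi> X i q = (if q \<in> dom_chart c then \<psi> q * (to_chart A c q (X q) \<bullet> i) else 0)"

text \<open>No plateau around p is constructed: the value 1 at p is enough for pointwise identities,
  and by continuity \<psi> is nonzero near p, so that it can be inverted there.\<close>

lemma obtain_cutoff:
  assumes c: "c \<in> A" and p: "p \<in> dom_chart c"
  obtains \<psi> where "cutoff c \<psi>" "\<psi> p = 1"
proof -
  obtain r where r: "r > 0" "cball (map_chart c p) r \<subseteq> range_chart c"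
    using open_range[OF c] map_in_range[OF p] open_contains_cball by blast
  obtain h :: "'e \<Rightarrow> real" where h: "smooth_on UNIV h" "h (map_chart c p) = 1"
    "\<And>y. y \<notin> cball (map_chart c p) r \<Longrightarrow> h y = 0"
    using smooth_bump[OF r(1), of "map_chart c p"] by blast
  define \<psi> where "\<psi> q = (if q \<in> dom_chart c then h (map_chart c q) else 0)" for q
  let ?C = "inv_chart c ` cball (map_chart c p) r"
  \<comment> \<open>The image of a compact ball is compact, hence closed in the whole Hausdorff
    space and not merely in the chart domain.\<close>
  have C: "closed ?C" "?C \<subseteq> dom_chart c"
    using r(2) c continuous_on_subset[OF continuous_inv[OF c] r(2)]
    by (auto intro!: compact_imp_closed compact_continuous_image simp: inv_in_dom)
  have z: "\<psi> q = 0" if "q \<notin> ?C" for q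
  proof (cases "q \<in> dom_chart c")
    case True
    then have "map_chart c q \<notin> cball (map_chart c p) r"
      using that by (metis c image_eqI inv_map)
    then show ?thesis using h(3) by (simp add: \<psi>_def)
  qed (simp add: \<psi>_def)
  have "smooth_on (range_chart c) (\<psi> \<circ> inv_chart c)"
    by (rule smooth_on_cong[OF open_range[OF c] _ smooth_on_subset[OF h(1)]])
      (auto simp: \<psi>_def c inv_in_dom map_inv)
  then have "smooth_function A \<psi>"
    using smooth_function_zero_extension[OF c C] z by blast
  then have "cutoff c \<psi>" using C z c by (auto simp: cutoff_def)
  moreover have "\<psi> p = 1" using p h(2) by (simp add: \<psi>_def)
  ultimately show ?thesis using that by blast
qed

lemma vector_field_cutoff_const:
  assumes "cutoff c \<psi>"
  shows "vector_field A (cutoff_const c \<psi> v)"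
proof -
  from assms obtain C where C: "c \<in> A" "smooth_function A \<psi>" "closed C" "C \<subseteq> dom_chart c"
    "\<And>q. q \<notin> C \<Longrightarrow> \<psi> q = 0" by (auto simp: cutoff_def)
  have "smooth_on (range_chart c) (\<lambda>x. (\<psi> \<circ> inv_chart c) x *\<^sub>R v)"
    using C by (intro smooth_on_scaleR open_range) (auto simp: smooth_function_def comp_def)
  then have "smooth_on (range_chart c) (field_in_chart A c (cutoff_const c \<psi> v))"
    by (rule smooth_on_cong[OF open_range[OF C(1)], rotated])
      (simp add: field_in_chart_comp C(1) linear_scale[OF linear_to_chart] inv_in_dom cutoff_const_def)
  then show ?thesis
    by (rule vector_field_zero_extension[OF C(1,3,4), rotated]) (simp add: cutoff_const_def C(5))
qed

lemma smooth_function_cutoff_coeff: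
  assumes "cutoff c \<psi>" "vector_field A X"
  shows "smooth_function A (cutoff_coeff c \<psi> X i)"
proof -
  from assms obtain C where C: "c \<in> A" "smooth_function A \<psi>" "closed C" "C \<subseteq> dom_chart c"
    "\<And>q. q \<notin> C \<Longrightarrow> \<psi> q = 0" by (auto simp: cutoff_def)
  have "smooth_on (range_chart c) (\<lambda>x. (\<psi> \<circ> inv_chart c) x * (field_in_chart A c X x \<bullet> i))"
    using C assms(2) by (intro smooth_on_mult smooth_on_inner open_range)
      (auto simp: smooth_function_def vector_field_def comp_def)
  then have "smooth_on (range_chart c) (cutoff_coeff c \<psi> X i \<circ> inv_chart c)"
    by (rule smooth_on_cong[OF open_range[OF C(1)], rotated])
      (simp add: field_in_chart_comp C(1) inv_in_dom cutoff_coeff_def)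
  then show ?thesis
    by (rule smooth_function_zero_extension[OF C(1,3,4), rotated]) (simp add: cutoff_coeff_def C(5))
qed

lemma cutoff_expansion:
  assumes "cutoff c \<psi>"
  shows "(\<psi> q * \<psi> q) *\<^sub>R X q = (\<Sum>i\<in>Basis. cutoff_coeff c \<psi> X i q *\<^sub>R cutoff_const c \<psi> i q)"
proof (cases "q \<in> dom_chart c")
  case True
  have c: "c \<in> A" using assms by (simp add: cutoff_def)
  have "X q = from_chart A c q (to_chart A c q (X q))" using c True by simp
  also have "\<dots> = (\<Sum>i\<in>Basis. (to_chart A c q (X q) \<bullet> i) *\<^sub>R from_chart A c q i)"
    by (rule linear_Basis_sum[OF linear_from_chart[OF c True]])
  finally have "(\<psi> q * \<psi> q) *\<^sub>R X q =
      (\<psi> q * \<psi> q) *\<^sub>R (\<Sum>i\<in>Basis. (to_chart A c q (X q) \<bullet> i) *\<^sub>R from_chart A c q i)" by metis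
  then show ?thesis
    using True by (simp add: scaleR_sum_right cutoff_coeff_def cutoff_const_def ac_simps)
next
  case False
  then have "\<psi> q = 0" using assms by (auto simp: cutoff_def)
  then show ?thesis by (simp add: cutoff_coeff_def False)
qed

text \<open>Multiplying by the square of a cut-off function turns the expansion of a field in a chart into a
  global one.\<close>

lemma tensorial:
  fixes G :: "('m \<Rightarrow> 'e) \<Rightarrow> 'b::real_vector"
  assumes add: "\<And>X Y. vector_field A X \<Longrightarrow> vector_field A Y \<Longrightarrow> G (\<lambda>q. X q + Y q) = G X + G Y"
    and scale: "\<And>f X. smooth_function A f \<Longrightarrow> vector_field A X \<Longrightarrow> G (\<lambda>q. f q *\<^sub>R X q) = f p *\<^sub>R G X"
    and X: "vector_field A X" and Y: "vector_field A Y" and eq: "X p = Y p"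
  shows "G X = G Y"
proof -
  have zero: "G (\<lambda>q. 0) = 0"
    using scale[OF smooth_function_const[of 0] X] by simp
  have sum: "G (\<lambda>q. \<Sum>i\<in>I. Z i q) = (\<Sum>i\<in>I. G (Z i))"
    if "\<And>i. i \<in> I \<Longrightarrow> vector_field A (Z i)" for I :: "'e set" and Z
    using that
    by (induction I rule: infinite_finite_induct) (auto simp: zero add vector_field_sum)
  let ?c = "chart_at A p"
  obtain \<psi> where \<psi>: "cutoff ?c \<psi>" "\<psi> p = 1"
    using obtain_cutoff[OF chart_at] by blast
  have "G Z = (\<Sum>i\<in>Basis. (Z p \<bullet> i) *\<^sub>R G (cutoff_const ?c \<psi> i))" if Z: "vector_field A Z" for Z
  proof -
    have s: "smooth_function A \<psi>" using \<psi> by (simp add: cutoff_def)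
    \<comment> \<open>The inserted factor is 1 at p, and \<open>scale\<close> sees only its value
      there.\<close>
    have "G Z = G (\<lambda>q. (\<psi> q * \<psi> q) *\<^sub>R Z q)"
      using scale[OF smooth_function_mult[OF s s] Z] \<psi>(2) by simp
    also have "\<dots> = (\<Sum>i\<in>Basis. G (\<lambda>q. cutoff_coeff ?c \<psi> Z i q *\<^sub>R cutoff_const ?c \<psi> i q))"
      unfolding cutoff_expansion[OF \<psi>(1)]
      by (intro sum vector_field_scale smooth_function_cutoff_coeff vector_field_cutoff_const \<psi> Z)
    also have "\<dots> = (\<Sum>i\<in>Basis. (Z p \<bullet> i) *\<^sub>R G (cutoff_const ?c \<psi> i))"
      using scale[OF smooth_function_cutoff_coeff[OF \<psi>(1) Z] vector_field_cutoff_const[OF \<psi>(1)]]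
      by (simp add: cutoff_coeff_def \<psi>(2) chart_at)
    finally show ?thesis .
  qed
  then show ?thesis using X Y eq by simp
qed

text \<open>A cut-off constant field in \<open>chart_at A p\<close> is a witness for the choice; in
  this chart a tangent vector at p is its own component vector.\<close>

lemma extend_vector: "vector_field A (extend_vector A p v)" "extend_vector A p v p = v"
proof -
  obtain \<psi> where \<psi>: "cutoff (chart_at A p) \<psi>" "\<psi> p = 1"
    using obtain_cutoff[OF chart_at] by blast
  have "\<exists>X. vector_field A X \<and> X p = v"
    by (rule exI[of _ "cutoff_const (chart_at A p) \<psi> v"])
      (use \<psi> in \<open>simp add: vector_field_cutoff_const cutoff_const_def chart_at\<close>)
  from someI_ex[OF this] show "vector_field A (extend_vector A p v)" "extend_vector A p v p = v"
    by (simp_all add: extend_vector_def)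
qed

lemma field_components:
  assumes "c \<in> A" "q \<in> dom_chart c" "linear h"
  shows "h (X q) = (\<Sum>i\<in>Basis. (to_chart A c q (X q) \<bullet> i) *\<^sub>R h (from_chart A c q i))"
proof -
  have "linear (\<lambda>v. h (from_chart A c q v))"
    using linear_compose[OF linear_from_chart[OF assms(1,2)], of h] assms(3)
    by (simp add: comp_def)
  from linear_Basis_sum[OF this, of "to_chart A c q (X q)"] show ?thesis using assms by simp
qed

text \<open>\<open>one_form\<close> tests smoothness on coordinate vectors only; linearity and the
  components of X carry it over to fields.\<close>

lemma smooth_function_one_form:
  assumes "one_form A \<beta>" "vector_field A X"
  shows "smooth_function A (\<lambda>q. \<beta> q (X q))"
  unfolding smooth_function_def
proof
  fix c assume c: "c \<in> A"
  have "smooth_on (range_chart c) (\<lambda>x. \<Sum>i\<in>Basis. (field_in_chart A c X x \<bullet> i) *\<^sub>R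
      ((\<lambda>p. \<beta> p (from_chart A c p i)) \<circ> inv_chart c) x)"
    using assms c by (intro smooth_on_sum smooth_on_scaleR smooth_on_inner open_range)
      (auto simp: vector_field_def one_form_def comp_def)
  then show "smooth_on (range_chart c) ((\<lambda>q. \<beta> q (X q)) \<circ> inv_chart c)"
    by (rule smooth_on_cong[OF open_range[OF c], rotated])
      (use assms c field_components[OF c inv_in_dom[OF c], of _ "\<beta> _" X]
        in \<open>auto simp: field_in_chart_comp one_form_def\<close>)
qed

lemma smooth_function_metric:
  assumes "riemannian_metric A \<alpha>" "vector_field A X" "vector_field A Y"
  shows "smooth_function A (\<lambda>q. \<alpha> q (X q) (Y q))"
  unfolding smooth_function_def
proof
  fix c assume c: "c \<in> A"
  have bl: "linear (\<lambda>v. \<alpha> q v w)" "linear (\<lambda>v. \<alpha> q w v)" for q w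
    using assms(1) by (auto simp: riemannian_metric_def bilinear_def)
  have "smooth_on (range_chart c) (\<lambda>x. \<Sum>i\<in>Basis. (field_in_chart A c X x \<bullet> i) *\<^sub>R
      (\<Sum>j\<in>Basis. (field_in_chart A c Y x \<bullet> j) *\<^sub>R
      ((\<lambda>p. \<alpha> p (from_chart A c p i) (from_chart A c p j)) \<circ> inv_chart c) x))"
    using assms c by (intro smooth_on_sum smooth_on_scaleR smooth_on_inner open_range)
      (auto simp: vector_field_def riemannian_metric_def comp_def)
  then show "smooth_on (range_chart c) ((\<lambda>q. \<alpha> q (X q) (Y q)) \<circ> inv_chart c)"
  proof (rule smooth_on_cong[OF open_range[OF c], rotated])
    fix x assume x: "x \<in> range_chart c"
    let ?q = "inv_chart c x"
    have q: "?q \<in> dom_chart c" using c x by (rule inv_in_dom)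
    have "\<alpha> ?q (X ?q) (Y ?q) = (\<Sum>i\<in>Basis. (to_chart A c ?q (X ?q) \<bullet> i) *\<^sub>R
        \<alpha> ?q (from_chart A c ?q i) (Y ?q))"
      by (rule field_components[OF c q, where h = "\<lambda>v. \<alpha> ?q v (Y ?q)"]) (use bl in auto)
    also have "\<dots> = (\<Sum>i\<in>Basis. (to_chart A c ?q (X ?q) \<bullet> i) *\<^sub>R
        (\<Sum>j\<in>Basis. (to_chart A c ?q (Y ?q) \<bullet> j) *\<^sub>R
          \<alpha> ?q (from_chart A c ?q i) (from_chart A c ?q j)))"
      by (intro sum.cong refl arg_cong2[where f = "(*\<^sub>R)"] field_components[OF c q]) (use bl in auto)
    finally show "(\<Sum>i\<in>Basis. (field_in_chart A c X x \<bullet> i) *\<^sub>R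
      (\<Sum>j\<in>Basis. (field_in_chart A c Y x \<bullet> j) *\<^sub>R
      ((\<lambda>p. \<alpha> p (from_chart A c p i) (from_chart A c p j)) \<circ> inv_chart c) x)) =
      ((\<lambda>q. \<alpha> q (X q) (Y q)) \<circ> inv_chart c) x"
      using x c by (simp add: field_in_chart_comp)
  qed
qed

lemma smooth_function_has_derivative:
  assumes "smooth_function A f" "c \<in> A" "p \<in> dom_chart c"
  shows "((f \<circ> inv_chart c) has_derivative frechet_derivative (f \<circ> inv_chart c) (at (map_chart c p)))
    (at (map_chart c p))"
  using assms smooth_on_has_derivative map_in_range unfolding smooth_function_def by blast

lemma dir_deriv_cong: "X p = Y p \<Longrightarrow> dir_deriv A X f p = dir_deriv A Y f p"
  by (simp add: dir_deriv_def)

lemma dir_deriv_eqI: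
  "((f \<circ> inv_chart (chart_at A p)) has_derivative L) (at (map_chart (chart_at A p) p)) \<Longrightarrow>
    dir_deriv A X f p = L (X p)"
  unfolding dir_deriv_def Let_def using frechet_derivative_at by metis

lemma dir_deriv_add:
  assumes "smooth_function A f" "smooth_function A g"
  shows "dir_deriv A X (\<lambda>q. f q + g q) p = dir_deriv A X f p + dir_deriv A X g p"
  using dir_deriv_eqI[of "\<lambda>q. f q + g q" p, unfolded comp_def,
      OF has_derivative_add[OF smooth_function_has_derivative[OF assms(1) chart_at, unfolded comp_def]
        smooth_function_has_derivative[OF assms(2) chart_at, unfolded comp_def]], of X]
  by (simp add: dir_deriv_def Let_def comp_def)

lemma dir_deriv_mult:
  assumes "smooth_function A f" "smooth_function A g"
  shows "dir_deriv A X (\<lambda>q. f q * g q) p = dir_deriv A X f p * g p + f p * dir_deriv A X g p"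
  using dir_deriv_eqI[of "\<lambda>q. f q * g q" p, unfolded comp_def,
      OF has_derivative_mult[OF smooth_function_has_derivative[OF assms(1) chart_at, unfolded comp_def]
        smooth_function_has_derivative[OF assms(2) chart_at, unfolded comp_def]], of X]
  by (simp add: dir_deriv_def Let_def comp_def inv_map chart_at)

end

section \<open>Linear differential equations\<close>

text \<open>Picard iteration: on a short interval the integral operator is a contraction. Its argument is
  clamped to the interval in order to act on bounded continuous functions on the whole line.\<close>

lemma linear_ode_continuous:
  fixes M :: "real \<Rightarrow> 'e::euclidean_space \<Rightarrow> 'e"
  assumes lin: "\<And>t. linear (M t)"
    and cont: "\<And>y. continuous_on {-d..d} y \<Longrightarrow> continuous_on {-d..d} (\<lambda>t. M t (y t))"
    and bound: "\<And>t v. t \<in> {-d..d} \<Longrightarrow> norm (M t v) \<le> C * norm v"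
    and d: "d > 0" "C * d \<le> 1/2"
  obtains y where "y 0 = y0"
    "\<And>t. t \<in> {-d<..<d} \<Longrightarrow> (y has_vector_derivative M t (y t)) (at t)"
proof -
  define cl where "cl t = max (-d) (min d t)" for t
  have cl: "cl t \<in> {-d..d}" "\<And>t. t \<in> {-d..d} \<Longrightarrow> cl t = t" for t
    using d by (auto simp: cl_def)
  define h where "h y t = M t (apply_bcontfun y t)" for y t
  have hc: "continuous_on {-d..d} (h y)" for y
    unfolding h_def by (rule cont) auto
  define G where "G y s = integral {-d..s} (h y)" for y s
  have G: "(G y has_vector_derivative h y s) (at s within {-d..d})" if "s \<in> {-d..d}" for y s
    unfolding G_def by (rule integral_has_vector_derivative[OF hc that])
  have Gc: "continuous_on {-d..d} (G y)" for y
    unfolding continuous_on_eq_continuous_within by (blast intro: has_vector_derivative_continuous[OF G])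
  \<comment> \<open>\<open>G\<close> integrates from -d. Subtracting its value at 0 moves the base
    point to 0, where every iterate takes the value \<open>y0\<close>.\<close>
  define F where "F y t = y0 + G y (cl t) - G y 0" for y t
  have F: "F y \<in> bcontfun" for y
  proof -
    have c: "continuous_on UNIV (\<lambda>t. G y (cl t))"
      by (rule continuous_on_compose2[OF Gc]) (use cl(1) in \<open>auto simp: cl_def intro!: continuous_intros\<close>)
    have "bounded (G y ` {-d..d})"
      by (intro compact_imp_bounded compact_continuous_image Gc) auto
    then obtain b where "\<And>s. s \<in> {-d..d} \<Longrightarrow> norm (G y s) \<le> b"
      unfolding bounded_iff by blast
    then have "norm (F y t) \<le> norm y0 + b + norm (G y 0)" for t
      unfolding F_def using cl(1)[of t]
      by (smt (verit, best) norm_triangle_ineq norm_triangle_ineq4)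
    then show ?thesis
      by (intro bcontfun_normI) (auto simp: F_def intro!: continuous_intros c)
  qed
  define \<Phi> where "\<Phi> y = Bcontfun (F y)" for y
  have \<Phi>: "apply_bcontfun (\<Phi> y) = F y" for y
    unfolding \<Phi>_def by (rule Bcontfun_inverse[OF F])
  have contr: "dist (\<Phi> y) (\<Phi> z) \<le> 1/2 * dist y z" for y z
  proof (rule dist_bound)
    fix t
    have C: "C \<ge> 0"
    proof -
      obtain b :: 'e where "b \<in> Basis" by fastforce
      then show ?thesis
        using bound[of 0 b] d(1) norm_ge_zero[of "M 0 b"] by (simp del: norm_ge_zero)
    qed
    \<comment> \<open>All iterates agree at 0, so the mean value inequality on the segment from 0 to
      \<open>cl t\<close>, of length at most d, bounds their distance;
      \<open>C * d \<le> 1/2\<close> then makes the operator a contraction.\<close>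
    have "norm ((G y (cl t) - G z (cl t)) - (G y 0 - G z 0)) \<le> C * dist y z * norm (cl t - 0)"
    proof (rule differentiable_bound)
      show "convex {-d..d}" by simp
      show "cl t \<in> {-d..d}" "0 \<in> {-d..d}" using cl d by auto
      fix s assume s: "s \<in> {-d..d}"
      show "((\<lambda>s. G y s - G z s) has_derivative (\<lambda>x. x *\<^sub>R (h y s - h z s))) (at s within {-d..d})"
        using has_vector_derivative_diff[OF G[OF s] G[OF s]] by (simp add: has_vector_derivative_def)
      have "norm (h y s - h z s) = norm (M s (apply_bcontfun y s - apply_bcontfun z s))"
        by (simp add: h_def linear_diff[OF lin])
      also have "\<dots> \<le> C * dist (apply_bcontfun y s) (apply_bcontfun z s)"
        using bound[OF s] by (simp add: dist_norm)
      also have "\<dots> \<le> C * dist y z"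
        using C by (intro mult_left_mono dist_bounded)
      finally show "onorm (\<lambda>x. x *\<^sub>R (h y s - h z s)) \<le> C * dist y z"
        by (intro onorm_le) (simp add: mult.commute mult_left_mono)
    qed
    also have "\<dots> \<le> C * dist y z * d"
      using cl(1)[of t] C by (intro mult_left_mono) auto
    also have "\<dots> = (C * d) * dist y z" by simp
    also have "\<dots> \<le> 1/2 * dist y z" by (intro mult_right_mono d) simp
    finally show "dist (apply_bcontfun (\<Phi> y) t) (apply_bcontfun (\<Phi> z) t) \<le> 1/2 * dist y z"
      by (simp add: \<Phi> F_def dist_norm algebra_simps)
  qed
  obtain y where y: "\<Phi> y = y"
    using banach_fix_type[of "1/2" \<Phi>] contr by auto
  have yF: "apply_bcontfun y t = y0 + G y t - G y 0" if "t \<in> {-d..d}" for t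
    using \<Phi>[of y] cl(2)[OF that] by (simp add: y F_def)
  show ?thesis
  proof
    show "apply_bcontfun y 0 = y0" using yF[of 0] d by simp
    fix t assume t: "t \<in> {-d<..<d}"
    have "((\<lambda>t. y0 + G y t - G y 0) has_vector_derivative h y t) (at t within {-d..d})"
      using G[of t y] t by (auto intro!: derivative_eq_intros)
    then have "((\<lambda>t. y0 + G y t - G y 0) has_vector_derivative h y t) (at t)"
      using t by (simp add: at_within_Icc_at)
    then show "(apply_bcontfun y has_vector_derivative M t (apply_bcontfun y t)) (at t)"
      unfolding h_def[symmetric]
      by (rule has_vector_derivative_transform_within_open[of _ _ _ "{-d<..<d}"]) (use t yF in auto)
  qed
qed

text \<open>The coefficients may be unbounded on the open interval, so the equation is solved on a
  shorter closed one. \<open>L i\<close> is the i-th column of the coefficient matrix.\<close>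

lemma linear_ode:
  fixes L :: "'e::euclidean_space \<Rightarrow> real \<Rightarrow> 'e"
  assumes "\<epsilon> > 0" and smooth: "\<And>i. i \<in> Basis \<Longrightarrow> smooth_on {-\<epsilon><..<\<epsilon>} (L i)"
  obtains d y where "0 < d" "d \<le> \<epsilon>" "smooth_on {-d<..<d} y" "y 0 = y0"
    "\<And>t. t \<in> {-d<..<d} \<Longrightarrow> (y has_vector_derivative (\<Sum>i\<in>Basis. (y t \<bullet> i) *\<^sub>R L i t)) (at t)"
proof -
  define M where "M t v = (\<Sum>i\<in>Basis. (v \<bullet> i) *\<^sub>R L i t)" for t and v :: 'e
  have cL: "continuous_on {-\<epsilon><..<\<epsilon>} (L i)" if "i \<in> Basis" for i
    using smooth_on_continuous smooth that by blast
  have cS: "continuous_on {-\<epsilon>/2..\<epsilon>/2} (\<lambda>t. \<Sum>i\<in>Basis. norm (L i t))"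
    by (intro continuous_intros continuous_on_subset[OF cL]) (use assms(1) in auto)
  have "bounded ((\<lambda>t. \<Sum>i\<in>Basis. norm (L i t)) ` {-\<epsilon>/2..\<epsilon>/2})"
    by (intro compact_imp_bounded compact_continuous_image cS) simp
  then obtain C where C: "C > 0" "\<And>t. t \<in> {-\<epsilon>/2..\<epsilon>/2} \<Longrightarrow> norm (\<Sum>i\<in>Basis. norm (L i t)) \<le> C"
    unfolding bounded_pos by auto
  \<comment> \<open>The first bound keeps [-d, d] where C dominates the coefficients, the second one
    yields the contraction factor 1/2.\<close>
  define d where "d = min (\<epsilon>/2) (1 / (2 * C))"
  have d: "0 < d" "d < \<epsilon>" "d \<le> \<epsilon>/2" "C * d \<le> 1/2"
    using assms(1) C(1) by (auto simp: d_def min_def field_simps)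
  obtain y where y: "y 0 = y0" "\<And>t. t \<in> {-d<..<d} \<Longrightarrow> (y has_vector_derivative M t (y t)) (at t)"
  proof (rule linear_ode_continuous[of M d C y0])
    show "linear (M t)" for t
      unfolding M_def
      by (rule linearI) (simp_all add: inner_add_left scaleR_add_left sum.distrib scaleR_sum_right)
    show "continuous_on {-d..d} (\<lambda>t. M t (y t))" if "continuous_on {-d..d} y" for y
      unfolding M_def
      by (intro continuous_intros that continuous_on_subset[OF cL]) (use d in auto)
    show "norm (M t v) \<le> C * norm v" if "t \<in> {-d..d}" for t v
    proof -
      have "norm (M t v) \<le> (\<Sum>i\<in>Basis. norm (L i t) * norm v)"
        unfolding M_def
        by (rule sum_norm_le) (simp add: Basis_le_norm mult.commute[of "norm (L _ t)"] mult_right_mono)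
      also have "\<dots> = norm (\<Sum>i\<in>Basis. norm (L i t)) * norm v"
        by (simp add: sum_distrib_right sum_nonneg)
      also have "\<dots> \<le> C * norm v"
        using C(2)[of t] that d by (intro mult_right_mono) auto
      finally show ?thesis .
    qed
  qed (use d in auto)
  \<comment> \<open>Bootstrapping: the equation expresses the derivative of y through y, so each
    order of smoothness yields the next.\<close>
  have "Ck_on k {-d<..<d} y" for k
  proof (induction k)
    case 0
    have "isCont y t" if "t \<in> {-d<..<d}" for t
      using has_vector_derivative_continuous[OF y(2)[OF that]] .
    then show ?case by (simp add: continuous_at_imp_continuous_on)
  next
    case (Suc k)
    have "Ck_on k {-d<..<d} (\<lambda>t. M t (y t))"
      unfolding M_def
    proof (intro Ck_on_sum Ck_on_bilinear[OF bounded_bilinear_scaleR]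
        Ck_on_bounded_linear[OF bounded_linear_inner_left] Suc)
      show "Ck_on k {-d<..<d} (L i)" if "i \<in> Basis" for i
      proof (rule Ck_on_subset)
        show "Ck_on k {-\<epsilon><..<\<epsilon>} (L i)" using smooth[OF that] unfolding smooth_on_def by blast
      qed (use d(2) in auto)
    qed auto
    then show ?case
      by (rule Ck_on_vector_derivative[rotated 2]) (use y in auto)
  qed
  then have "smooth_on {-d<..<d} y" unfolding smooth_on_def by blast
  then show ?thesis
    using that[where d = d and y = y] d(1) less_imp_le[OF d(2)] y unfolding M_def by blast
qed

section \<open>Derivatives along curves\<close>

context smooth_manifold
begin

lemma connection_field:
  "linear_connection A D \<Longrightarrow> vector_field A X \<Longrightarrow> vector_field A Y \<Longrightarrow> vector_field A (D X Y)"
  and connection_add_left: "linear_connection A D \<Longrightarrow> vector_field A X \<Longrightarrow> vector_field A X' \<Longrightarrow>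
    vector_field A Y \<Longrightarrow> D (\<lambda>p. X p + X' p) Y p = D X Y p + D X' Y p"
  and connection_scale_left: "linear_connection A D \<Longrightarrow> smooth_function A f \<Longrightarrow> vector_field A X \<Longrightarrow>
    vector_field A Y \<Longrightarrow> D (\<lambda>p. f p *\<^sub>R X p) Y p = f p *\<^sub>R D X Y p"
  and connection_add_right: "linear_connection A D \<Longrightarrow> vector_field A X \<Longrightarrow> vector_field A Y \<Longrightarrow>
    vector_field A Y' \<Longrightarrow> D X (\<lambda>p. Y p + Y' p) p = D X Y p + D X Y' p"
  and connection_scale_right: "linear_connection A D \<Longrightarrow> smooth_function A f \<Longrightarrow> vector_field A X \<Longrightarrow>
    vector_field A Y \<Longrightarrow> D X (\<lambda>p. f p *\<^sub>R Y p) p = dir_deriv A X f p *\<^sub>R Y p + f p *\<^sub>R D X Y p"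
  unfolding linear_connection_def by (auto dest: fun_cong)

text \<open>D is linear over smooth functions in its first argument, which is all that
  \<open>tensorial\<close> asks for.\<close>

lemma connection_cong_left:
  assumes D: "linear_connection A D"
    and "vector_field A X" "vector_field A X'" "vector_field A Y" "X p = X' p"
  shows "D X Y p = D X' Y p"
  by (rule tensorial[where G = "\<lambda>X. D X Y p" and p = p])
    (use assms in \<open>auto simp: connection_add_left[OF D] connection_scale_left[OF D]\<close>)

text \<open>Smoothness is tested on fields so that not only \<beta> but also \<alpha>(_, Z) for a
  field Z is an instance. Statements about the metric thereby reduce to statements about
  forms.\<close>

definition smooth_form :: "('m \<Rightarrow> 'e \<Rightarrow> real) \<Rightarrow> bool" where
  "smooth_form \<beta> \<longleftrightarrow> (\<forall>q. linear (\<beta> q)) \<and>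
     (\<forall>Y. vector_field A Y \<longrightarrow> smooth_function A (\<lambda>q. \<beta> q (Y q)))"

lemma smooth_form_one_form: "one_form A \<beta> \<Longrightarrow> smooth_form \<beta>"
  by (simp add: smooth_form_def smooth_function_one_form) (simp add: one_form_def)

lemma metric_linear:
  assumes "riemannian_metric A \<alpha>"
  shows "linear (\<alpha> p u)" "linear (\<lambda>v. \<alpha> p v u)" "\<alpha> p u v = \<alpha> p v u" "bilinear (\<alpha> p)"
    "u \<noteq> 0 \<Longrightarrow> \<alpha> p u u > 0"
  using assms by (auto simp: riemannian_metric_def bilinear_def)

lemma smooth_form_metric:
  "riemannian_metric A \<alpha> \<Longrightarrow> vector_field A Z \<Longrightarrow> smooth_form (\<lambda>q v. \<alpha> q v (Z q))"
  by (simp add: smooth_form_def smooth_function_metric metric_linear)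

text \<open>\<open>(D\<^sub>X \<beta>)(Y)\<close> and \<open>(D\<^sub>X \<alpha>)(Y, Z)\<close>.\<close>

definition form_defect ::
  "('m, 'e) connection \<Rightarrow> ('m \<Rightarrow> 'e \<Rightarrow> real) \<Rightarrow> ('m \<Rightarrow> 'e) \<Rightarrow> ('m \<Rightarrow> 'e) \<Rightarrow> 'm \<Rightarrow> real" where
  "form_defect D \<beta> X Y p = dir_deriv A X (\<lambda>q. \<beta> q (Y q)) p - \<beta> p (D X Y p)"

definition metric_defect ::
  "('m, 'e) connection \<Rightarrow> ('m \<Rightarrow> 'e \<Rightarrow> 'e \<Rightarrow> real) \<Rightarrow> ('m \<Rightarrow> 'e) \<Rightarrow> ('m \<Rightarrow> 'e) \<Rightarrow> ('m \<Rightarrow> 'e) \<Rightarrow>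
    'm \<Rightarrow> real" where
  "metric_defect D \<alpha> X Y Z p = dir_deriv A X (\<lambda>q. \<alpha> q (Y q) (Z q)) p
     - \<alpha> p (D X Y p) (Z p) - \<alpha> p (Y p) (D X Z p)"

context
  fixes D assumes D: "linear_connection A D"
begin

lemma form_defect_add:
  assumes "smooth_form \<beta>" "vector_field A X" "vector_field A Y" "vector_field A Z"
  shows "form_defect D \<beta> X (\<lambda>q. Y q + Z q) p = form_defect D \<beta> X Y p + form_defect D \<beta> X Z p"
  using assms
  by (simp add: form_defect_def smooth_form_def linear_add dir_deriv_add connection_add_right[OF D])

text \<open>The Leibniz term X(f) \<beta>(Y) occurs in both summands and cancels. The defect is
  therefore a tensor also in Y, although neither summand is.\<close>

lemma form_defect_scale:
  assumes "smooth_form \<beta>" "vector_field A X" "vector_field A Y" "smooth_function A f"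
  shows "form_defect D \<beta> X (\<lambda>q. f q *\<^sub>R Y q) p = f p * form_defect D \<beta> X Y p"
  using assms
  by (simp add: form_defect_def smooth_form_def linear_add linear_scale dir_deriv_mult
      connection_scale_right[OF D] algebra_simps)

lemma form_defect_cong:
  assumes "smooth_form \<beta>" "vector_field A X" "vector_field A X'" "vector_field A Y" "vector_field A Y'"
    "X p = X' p" "Y p = Y' p"
  shows "form_defect D \<beta> X Y p = form_defect D \<beta> X' Y' p"
proof -
  have "form_defect D \<beta> X Y p = form_defect D \<beta> X Y' p"
    by (rule tensorial[where p = p and G = "\<lambda>Y. form_defect D \<beta> X Y p"])
      (use assms in \<open>auto simp: form_defect_add form_defect_scale\<close>)
  also have "\<dots> = form_defect D \<beta> X' Y' p"
    using assms connection_cong_left[OF D, of X X' Y' p] dir_deriv_cong[of X p X']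
    by (simp add: form_defect_def)
  finally show ?thesis .
qed

lemma form_defect_sum:
  assumes "smooth_form \<beta>" "vector_field A X" "\<And>i. i \<in> I \<Longrightarrow> vector_field A (Y i)" "finite I"
  shows "form_defect D \<beta> X (\<lambda>q. \<Sum>i\<in>I. r i *\<^sub>R Y i q) p = (\<Sum>i\<in>I. r i * form_defect D \<beta> X (Y i) p)"
  using assms(4,3)
proof (induction I)
  case empty
  show ?case
    using form_defect_scale[OF assms(1,2) vector_field_zero smooth_function_const[of 0]] by simp
next
  case (insert i I)
  then show ?case
    by (simp add: form_defect_add[OF assms(1,2)] vector_field_cmult vector_field_sum
        form_defect_scale[OF assms(1,2) _ smooth_function_const])
qed

text \<open>Freezing Z turns \<alpha> into a form. Through this identity
  \<open>metric_defect\<close> inherits its tensor properties in Y; those in Z follow by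
  symmetry.\<close>

lemma form_defect_metric:
  "form_defect D (\<lambda>q v. \<alpha> q v (Z q)) X Y p = metric_defect D \<alpha> X Y Z p + \<alpha> p (Y p) (D X Z p)"
  by (simp add: form_defect_def metric_defect_def)

lemma metric_defect_commute:
  "riemannian_metric A \<alpha> \<Longrightarrow> metric_defect D \<alpha> X Y Z p = metric_defect D \<alpha> X Z Y p"
  by (simp add: metric_defect_def metric_linear(3)[of \<alpha> _ _ "Z _"]
      metric_linear(3)[of \<alpha> _ _ "D X Z p"])

lemma metric_defect_cong:
  assumes \<alpha>: "riemannian_metric A \<alpha>"
    and "vector_field A X" "vector_field A X'" "vector_field A Y" "vector_field A Y'"
    "vector_field A Z" "vector_field A Z'"
    "X p = X' p" "Y p = Y' p" "Z p = Z' p"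
  shows "metric_defect D \<alpha> X Y Z p = metric_defect D \<alpha> X' Y' Z' p"
proof -
  have *: "metric_defect D \<alpha> X Y Z p = metric_defect D \<alpha> X' Y' Z p"
    if "vector_field A X" "vector_field A X'" "vector_field A Y" "vector_field A Y'" "vector_field A Z"
      "X p = X' p" "Y p = Y' p" for X X' Y Y' Z
    using form_defect_cong[OF smooth_form_metric[OF \<alpha> that(5)] that(1-4,6,7)]
      connection_cong_left[OF D that(1,2,5,6)] that
    by (simp add: form_defect_metric)
  have "metric_defect D \<alpha> X Y Z p = metric_defect D \<alpha> X' Y' Z p"
    using * assms by blast
  also have "\<dots> = metric_defect D \<alpha> X' Z Y' p" by (rule metric_defect_commute[OF \<alpha>])
  also have "\<dots> = metric_defect D \<alpha> X' Z' Y' p" using * assms by blast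
  also have "\<dots> = metric_defect D \<alpha> X' Y' Z' p" by (rule metric_defect_commute[OF \<alpha>])
  finally show ?thesis .
qed

lemma metric_defect_sum:
  assumes \<alpha>: "riemannian_metric A \<alpha>"
    and X: "vector_field A X" and Z: "vector_field A Z"
    and Y: "\<And>i. i \<in> I \<Longrightarrow> vector_field A (Y i)" and I: "finite I"
  shows "metric_defect D \<alpha> X Z (\<lambda>q. \<Sum>i\<in>I. r i *\<^sub>R Y i q) p =
    (\<Sum>i\<in>I. r i * metric_defect D \<alpha> X Z (Y i) p)"
proof -
  have "form_defect D (\<lambda>q v. \<alpha> q v (Z q)) X (\<lambda>q. \<Sum>i\<in>I. r i *\<^sub>R Y i q) p =
      (\<Sum>i\<in>I. r i * form_defect D (\<lambda>q v. \<alpha> q v (Z q)) X (Y i) p)"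
    by (rule form_defect_sum[OF smooth_form_metric[OF \<alpha> Z] X Y I])
  then show ?thesis
    by (simp add: form_defect_metric metric_defect_commute[OF \<alpha>, of X Z] sum.distrib algebra_simps
        linear_sum[OF metric_linear(2)[OF \<alpha>]] linear_scale[OF metric_linear(2)[OF \<alpha>]])
qed

end

section \<open>Product rules along curves\<close>

lemma smooth_curve_open:
  assumes "smooth_curve A I \<gamma>" "open I" "c \<in> A"
  shows "open {t \<in> I. \<gamma> t \<in> dom_chart c}"
proof -
  have "{t \<in> I. \<gamma> t \<in> dom_chart c} = I \<inter> \<gamma> -` dom_chart c" by auto
  then show ?thesis
    using assms continuous_open_preimage[of I \<gamma> "dom_chart c"] open_dom by (auto simp: smooth_curve_def)
qed

lemma velocity:
  assumes "smooth_curve A I \<gamma>" "t \<in> I"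
  shows "((map_chart (chart_at A (\<gamma> t)) \<circ> \<gamma>) has_vector_derivative velocity A \<gamma> t) (at t)"
proof -
  have "(map_chart (chart_at A (\<gamma> t)) \<circ> \<gamma>) differentiable (at t)"
    by (rule smooth_on_differentiable[of "{s \<in> I. \<gamma> s \<in> dom_chart (chart_at A (\<gamma> t))}"])
      (use assms chart_at in \<open>auto simp: smooth_curve_def\<close>)
  then show ?thesis
    by (simp add: velocity_def vector_derivative_works)
qed

lemma function_along_curve:
  assumes \<gamma>: "smooth_curve A I \<gamma>" "open I" "t \<in> I" and f: "smooth_function A f"
    and X: "X (\<gamma> t) = velocity A \<gamma> t"
  shows "((\<lambda>s. f (\<gamma> s)) has_real_derivative dir_deriv A X f (\<gamma> t)) (at t)"
proof -
  let ?c = "chart_at A (\<gamma> t)"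
  have "(((f \<circ> inv_chart ?c) \<circ> (map_chart ?c \<circ> \<gamma>)) has_derivative
      (frechet_derivative (f \<circ> inv_chart ?c) (at (map_chart ?c (\<gamma> t))) \<circ> (\<lambda>r. r *\<^sub>R velocity A \<gamma> t))) (at t)"
    using velocity[OF \<gamma>(1,3)] smooth_function_has_derivative[OF f chart_at]
    by (intro diff_chain_at) (simp_all add: has_vector_derivative_def)
  then have "((\<lambda>s. f (\<gamma> s)) has_derivative
      (frechet_derivative (f \<circ> inv_chart ?c) (at (map_chart ?c (\<gamma> t))) \<circ> (\<lambda>r. r *\<^sub>R velocity A \<gamma> t))) (at t)"
    by (rule has_derivative_transform_within_open[OF _ smooth_curve_open[OF \<gamma>(1,2), of ?c]])
      (use \<gamma>(3) chart_at in \<open>auto simp: inv_map\<close>)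
  then show ?thesis
    unfolding has_field_derivative_def
    by (rule has_derivative_eq_rhs)
      (use linear_scale[OF has_derivative_linear[OF smooth_function_has_derivative[OF f chart_at]]] X
        in \<open>auto simp: dir_deriv_def Let_def fun_eq_iff\<close>)
qed

text \<open>The product rule d/ds \<beta>(V) = \<beta>(w) + (D_X \<beta>)(V). It is derived from
  whichever decomposition of V witnesses the covariant derivative w; since the defect depends only
  on values at \<gamma> t, the decomposition and its extension of the velocity disappear from the
  result.\<close>

lemma form_along_curve:
  assumes D: "linear_connection A D" and \<beta>: "smooth_form \<beta>"
    and \<gamma>: "smooth_curve A I \<gamma>" "open I" "t \<in> I"
    and w: "has_cov_deriv_along A D \<gamma> V t w"
    and X: "vector_field A X" "X (\<gamma> t) = velocity A \<gamma> t" and Y: "vector_field A Y" "Y (\<gamma> t) = V t"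
  shows "((\<lambda>s. \<beta> (\<gamma> s) (V s)) has_real_derivative
    \<beta> (\<gamma> t) w + form_defect D \<beta> X Y (\<gamma> t)) (at t)"
proof -
  from w obtain n :: nat and f Z X' where
    fZ: "\<forall>i<n. f i differentiable (at t) \<and> vector_field A (Z i)"
    and X': "vector_field A X'" "X' (\<gamma> t) = velocity A \<gamma> t"
    and V: "\<forall>\<^sub>F s in nhds t. V s = (\<Sum>i<n. f i s *\<^sub>R Z i (\<gamma> s))"
    and w': "w = (\<Sum>i<n. vector_derivative (f i) (at t) *\<^sub>R Z i (\<gamma> t) + f i t *\<^sub>R D X' (Z i) (\<gamma> t))"
    unfolding has_cov_deriv_along_def by blast
  have Z: "vector_field A (Z i)" and f: "f i differentiable (at t)" if "i < n" for i
    using fZ that by auto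
  have lin: "linear (\<beta> q)" for q using \<beta> by (simp add: smooth_form_def)
  have der: "((\<lambda>s. \<Sum>i<n. f i s * \<beta> (\<gamma> s) (Z i (\<gamma> s))) has_real_derivative
      (\<Sum>i<n. vector_derivative (f i) (at t) * \<beta> (\<gamma> t) (Z i (\<gamma> t))
        + f i t * dir_deriv A X' (\<lambda>q. \<beta> q (Z i q)) (\<gamma> t))) (at t)"
  proof (rule DERIV_sum)
    fix i assume "i \<in> {..<n}"
    then have i: "i < n" by simp
    have df: "(f i has_real_derivative vector_derivative (f i) (at t)) (at t)"
      using f[OF i] by (simp add: has_real_derivative_iff_has_vector_derivative vector_derivative_works)
    have "((\<lambda>s. \<beta> (\<gamma> s) (Z i (\<gamma> s))) has_real_derivative dir_deriv A X' (\<lambda>q. \<beta> q (Z i q)) (\<gamma> t)) (at t)"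
      by (rule function_along_curve[OF \<gamma>]) (use X'(2) \<beta> Z[OF i] in \<open>auto simp: smooth_form_def\<close>)
    from DERIV_mult[OF df this]
    show "((\<lambda>s. f i s * \<beta> (\<gamma> s) (Z i (\<gamma> s))) has_real_derivative
      vector_derivative (f i) (at t) * \<beta> (\<gamma> t) (Z i (\<gamma> t))
        + f i t * dir_deriv A X' (\<lambda>q. \<beta> q (Z i q)) (\<gamma> t)) (at t)"
      by (simp add: mult.commute add.commute)
  qed
  have eq: "(\<Sum>i<n. vector_derivative (f i) (at t) * \<beta> (\<gamma> t) (Z i (\<gamma> t))
        + f i t * dir_deriv A X' (\<lambda>q. \<beta> q (Z i q)) (\<gamma> t)) =
      \<beta> (\<gamma> t) w + (\<Sum>i<n. f i t * form_defect D \<beta> X' (Z i) (\<gamma> t))"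
    unfolding w' form_defect_def
    by (simp add: linear_sum[OF lin] linear_add[OF lin] linear_scale[OF lin] sum.distrib[symmetric]
        algebra_simps)
  \<comment> \<open>The combination of the Z_i with coefficients frozen at time t is a field of the
    manifold with value \<open>V t\<close> at \<open>\<gamma> t\<close>, so Y may replace
    it.\<close>
  have eq2: "(\<Sum>i<n. f i t * form_defect D \<beta> X' (Z i) (\<gamma> t)) = form_defect D \<beta> X Y (\<gamma> t)"
  proof -
    have "(\<Sum>i<n. f i t * form_defect D \<beta> X' (Z i) (\<gamma> t)) =
        form_defect D \<beta> X' (\<lambda>q. \<Sum>i<n. f i t *\<^sub>R Z i q) (\<gamma> t)"
      by (rule form_defect_sum[OF D \<beta> X'(1), symmetric]) (use Z in auto)
    also have "\<dots> = form_defect D \<beta> X Y (\<gamma> t)"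
      using eventually_nhds_x_imp_x[OF V] X X' Y Z
      by (intro form_defect_cong[OF D \<beta>] vector_field_sum vector_field_cmult) auto
    finally show ?thesis .
  qed
  have ev: "\<forall>\<^sub>F s in nhds t. \<beta> (\<gamma> s) (V s) = (\<Sum>i<n. f i s * \<beta> (\<gamma> s) (Z i (\<gamma> s)))"
    using V by eventually_elim (simp add: linear_sum[OF lin] linear_scale[OF lin])
  show ?thesis
    using der unfolding eq eq2 by (rule DERIV_cong_ev[OF refl ev refl, THEN iffD2])
qed

text \<open>Only the second V is expanded; each \<alpha>(V, Z_i) is covered by the product rule for
  the form \<alpha>(_, Z_i). The term \<alpha>(w, V) arises twice: from that rule, and from
  reassembling w out of the derivatives of the coefficients and of the Z_i.\<close>

lemma metric_along_curve:
  assumes D: "linear_connection A D" and \<alpha>: "riemannian_metric A \<alpha>"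
    and \<gamma>: "smooth_curve A I \<gamma>" "open I" "t \<in> I"
    and w: "has_cov_deriv_along A D \<gamma> V t w"
    and X: "vector_field A X" "X (\<gamma> t) = velocity A \<gamma> t" and Y: "vector_field A Y" "Y (\<gamma> t) = V t"
  shows "((\<lambda>s. \<alpha> (\<gamma> s) (V s) (V s)) has_real_derivative
    2 * \<alpha> (\<gamma> t) w (V t) + metric_defect D \<alpha> X Y Y (\<gamma> t)) (at t)"
proof -
  from w obtain n :: nat and f Z X' where
    fZ: "\<forall>i<n. f i differentiable (at t) \<and> vector_field A (Z i)"
    and X': "vector_field A X'" "X' (\<gamma> t) = velocity A \<gamma> t"
    and V: "\<forall>\<^sub>F s in nhds t. V s = (\<Sum>i<n. f i s *\<^sub>R Z i (\<gamma> s))"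
    and w': "w = (\<Sum>i<n. vector_derivative (f i) (at t) *\<^sub>R Z i (\<gamma> t) + f i t *\<^sub>R D X' (Z i) (\<gamma> t))"
    unfolding has_cov_deriv_along_def by blast
  have Z: "vector_field A (Z i)" and f: "f i differentiable (at t)" if "i < n" for i
    using fZ that by auto
  note lin = metric_linear(1)[OF \<alpha>]
  have Vt: "V t = (\<Sum>i<n. f i t *\<^sub>R Z i (\<gamma> t))"
    using eventually_nhds_x_imp_x[OF V] .
  have der: "((\<lambda>s. \<Sum>i<n. f i s * \<alpha> (\<gamma> s) (V s) (Z i (\<gamma> s))) has_real_derivative
      (\<Sum>i<n. vector_derivative (f i) (at t) * \<alpha> (\<gamma> t) (V t) (Z i (\<gamma> t))
        + f i t * (\<alpha> (\<gamma> t) w (Z i (\<gamma> t)) + metric_defect D \<alpha> X' Y (Z i) (\<gamma> t)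
            + \<alpha> (\<gamma> t) (V t) (D X' (Z i) (\<gamma> t))))) (at t)"
  proof (rule DERIV_sum)
    fix i assume "i \<in> {..<n}"
    then have i: "i < n" by simp
    have df: "(f i has_real_derivative vector_derivative (f i) (at t)) (at t)"
      using f[OF i] by (simp add: has_real_derivative_iff_has_vector_derivative vector_derivative_works)
    have "((\<lambda>s. \<alpha> (\<gamma> s) (V s) (Z i (\<gamma> s))) has_real_derivative
        \<alpha> (\<gamma> t) w (Z i (\<gamma> t)) + metric_defect D \<alpha> X' Y (Z i) (\<gamma> t)
            + \<alpha> (\<gamma> t) (V t) (D X' (Z i) (\<gamma> t))) (at t)"
      using form_along_curve[OF D smooth_form_metric[OF \<alpha> Z[OF i]] \<gamma> w X' Y]
      by (simp add: form_defect_metric[OF D] Y add.assoc)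
    from DERIV_mult[OF df this]
    show "((\<lambda>s. f i s * \<alpha> (\<gamma> s) (V s) (Z i (\<gamma> s))) has_real_derivative
      vector_derivative (f i) (at t) * \<alpha> (\<gamma> t) (V t) (Z i (\<gamma> t))
        + f i t * (\<alpha> (\<gamma> t) w (Z i (\<gamma> t)) + metric_defect D \<alpha> X' Y (Z i) (\<gamma> t)
            + \<alpha> (\<gamma> t) (V t) (D X' (Z i) (\<gamma> t)))) (at t)"
      by (simp add: mult.commute add.commute)
  qed
  have eq: "(\<Sum>i<n. vector_derivative (f i) (at t) * \<alpha> (\<gamma> t) (V t) (Z i (\<gamma> t))
        + f i t * (\<alpha> (\<gamma> t) w (Z i (\<gamma> t)) + metric_defect D \<alpha> X' Y (Z i) (\<gamma> t)
            + \<alpha> (\<gamma> t) (V t) (D X' (Z i) (\<gamma> t)))) =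
      2 * \<alpha> (\<gamma> t) w (V t) + metric_defect D \<alpha> X Y Y (\<gamma> t)"
  proof -
    have 1: "\<alpha> (\<gamma> t) (V t) w = (\<Sum>i<n. vector_derivative (f i) (at t) * \<alpha> (\<gamma> t) (V t) (Z i (\<gamma> t))
        + f i t * \<alpha> (\<gamma> t) (V t) (D X' (Z i) (\<gamma> t)))"
      unfolding w' by (simp only: linear_sum[OF lin] linear_add[OF lin] linear_scale[OF lin] real_scaleR_def)
    have 2: "\<alpha> (\<gamma> t) w (V t) = (\<Sum>i<n. f i t * \<alpha> (\<gamma> t) w (Z i (\<gamma> t)))"
      unfolding Vt by (simp only: linear_sum[OF lin] linear_add[OF lin] linear_scale[OF lin] real_scaleR_def)
    have "(\<Sum>i<n. f i t * metric_defect D \<alpha> X' Y (Z i) (\<gamma> t)) =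
        metric_defect D \<alpha> X' Y (\<lambda>q. \<Sum>i<n. f i t *\<^sub>R Z i q) (\<gamma> t)"
      by (rule metric_defect_sum[OF D \<alpha> X'(1) Y(1), symmetric]) (use Z in auto)
    also have "\<dots> = metric_defect D \<alpha> X Y Y (\<gamma> t)"
      using Vt X X' Y Z
      by (intro metric_defect_cong[OF D \<alpha>] vector_field_sum vector_field_cmult) auto
    finally have 3: "(\<Sum>i<n. f i t * metric_defect D \<alpha> X' Y (Z i) (\<gamma> t)) =
        metric_defect D \<alpha> X Y Y (\<gamma> t)" .
    have "2 * \<alpha> (\<gamma> t) w (V t) = \<alpha> (\<gamma> t) (V t) w + \<alpha> (\<gamma> t) w (V t)"
      using metric_linear(3)[OF \<alpha>, of "\<gamma> t" w "V t"] by simp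
    then show ?thesis
      unfolding 1 2 3[symmetric] by (simp add: sum.distrib[symmetric] algebra_simps)
  qed
  have ev: "\<forall>\<^sub>F s in nhds t. \<alpha> (\<gamma> s) (V s) (V s) = (\<Sum>i<n. f i s * \<alpha> (\<gamma> s) (V s) (Z i (\<gamma> s)))"
    using V
  proof eventually_elim
    case (elim s)
    have "\<alpha> (\<gamma> s) (V s) (V s) = \<alpha> (\<gamma> s) (V s) (\<Sum>i<n. f i s *\<^sub>R Z i (\<gamma> s))"
      using elim by simp
    then show ?case
      by (simp only: linear_sum[OF lin] linear_scale[OF lin] real_scaleR_def)
  qed
  show ?thesis
    using der unfolding eq by (rule DERIV_cong_ev[OF refl ev refl, THEN iffD2])
qed

end

section \<open>Compatible connections\<close>

context smooth_manifold
begin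

lemma has_cov_deriv_along_minus:
  assumes "has_cov_deriv_along A D \<gamma> V t w"
  shows "has_cov_deriv_along A D \<gamma> (\<lambda>t. - V t) t (- w)"
proof -
  from assms obtain n :: nat and f Z X where
    fZ: "\<forall>i<n. f i differentiable (at t) \<and> vector_field A (Z i)"
    and X: "vector_field A X" "X (\<gamma> t) = velocity A \<gamma> t"
    and V: "\<forall>\<^sub>F s in nhds t. V s = (\<Sum>i<n. f i s *\<^sub>R Z i (\<gamma> s))"
    and w: "w = (\<Sum>i<n. vector_derivative (f i) (at t) *\<^sub>R Z i (\<gamma> t) + f i t *\<^sub>R D X (Z i) (\<gamma> t))"
    unfolding has_cov_deriv_along_def by blast
  have d: "vector_derivative (\<lambda>s. - f i s) (at t) = - vector_derivative (f i) (at t)" if "i < n" for i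
    using fZ that by (intro vector_derivative_at has_vector_derivative_minus)
      (simp add: vector_derivative_works)
  show ?thesis
    unfolding has_cov_deriv_along_def
  proof (rule exI[of _ n], rule exI[of _ "\<lambda>i s. - f i s"], rule exI[of _ Z], rule exI[of _ X], intro conjI)
    show "\<forall>i<n. (\<lambda>s. - f i s) differentiable (at t) \<and> vector_field A (Z i)"
      using fZ by auto
    show "\<forall>\<^sub>F s in nhds t. - V s = (\<Sum>i<n. - f i s *\<^sub>R Z i (\<gamma> s))"
      using V by eventually_elim (simp add: sum_negf)
    have "- w = (\<Sum>i<n. - (vector_derivative (f i) (at t) *\<^sub>R Z i (\<gamma> t) + f i t *\<^sub>R D X (Z i) (\<gamma> t)))"
      unfolding w sum_negf by simp
    also have "\<dots> = (\<Sum>i<n. vector_derivative (\<lambda>s. - f i s) (at t) *\<^sub>R Z i (\<gamma> t) + - f i t *\<^sub>R D X (Z i) (\<gamma> t))"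
      by (rule sum.cong) (simp_all add: d)
    finally show "- w = \<dots>" .
  qed (use X in auto)
qed

lemma parallel_along_minus:
  assumes "parallel_along A D I \<gamma> V" "open I" "smooth_curve A I \<gamma>"
  shows "parallel_along A D I \<gamma> (\<lambda>t. - V t)"
  unfolding parallel_along_def smooth_field_along_def
proof (intro conjI ballI)
  show "has_cov_deriv_along A D \<gamma> (\<lambda>t. - V t) t 0" if "t \<in> I" for t
    using has_cov_deriv_along_minus[of D \<gamma> V t 0] assms(1) that by (simp add: parallel_along_def)
  fix c assume c: "c \<in> A"
  let ?S = "{t \<in> I. \<gamma> t \<in> dom_chart c}"
  have o: "open ?S" by (rule smooth_curve_open[OF assms(3,2) c])
  have "smooth_on ?S (\<lambda>t. - to_chart A c (\<gamma> t) (V t))"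
    by (rule smooth_on_linear[OF linear_uminus o])
      (use assms(1) c in \<open>auto simp: parallel_along_def smooth_field_along_def\<close>)
  then show "smooth_on ?S (\<lambda>t. to_chart A c (\<gamma> t) (- V t))"
    by (rule smooth_on_cong[OF o, rotated]) (auto simp: linear_neg[OF linear_to_chart[OF c]])
qed

text \<open>The curve is a straight line in the chart of p, so its velocity has the constant
  components u there. For V written in the cut-off coordinate fields \<open>Y i\<close>, being
  parallel is a linear system for the coefficients y.\<close>

lemma exists_parallel_field:
  assumes D: "linear_connection A D"
  obtains d \<gamma> V where "0 < d" "smooth_curve A {-d<..<d} \<gamma>" "\<gamma> 0 = p" "velocity A \<gamma> 0 = u"
    "parallel_along A D {-d<..<d} \<gamma> V" "V 0 = v"
proof -
  define c where "c = chart_at A p"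
  have c: "c \<in> A" "p \<in> dom_chart c" by (simp_all add: c_def chart_at)
  obtain \<psi> where \<psi>: "cutoff c \<psi>" "\<psi> p = 1" using obtain_cutoff[OF c] by blast
  have s\<psi>: "smooth_on (range_chart c) (\<psi> \<circ> inv_chart c)"
    using \<psi>(1) c(1) by (auto simp: cutoff_def smooth_function_def)
  define l where "l t = map_chart c p + t *\<^sub>R u" for t :: real
  define \<gamma> where "\<gamma> t = inv_chart c (l t)" for t
  have l: "smooth_on UNIV l"
    unfolding l_def by (intro smooth_on_add smooth_on_scaleR smooth_on_id) auto
  have dl: "(l has_vector_derivative u) (at t)" for t
    unfolding l_def by (auto intro!: derivative_eq_intros)
  \<comment> \<open>The line must stay where \<psi> is nonzero, since the equation is solved in the
    frame \<open>Y i\<close>.\<close>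
  define U where "U = {x \<in> range_chart c. (\<psi> \<circ> inv_chart c) x \<in> - {0}}"
  have "open U"
    unfolding U_def by (rule continuous_open_preimage[OF smooth_on_continuous[OF s\<psi>] open_range[OF c(1)],
          unfolded vimage_def, simplified Int_def mem_Collect_eq]) auto
  moreover have "l 0 \<in> U"
    using c \<psi>(2) by (simp add: U_def l_def inv_map map_in_range)
  ultimately have "open (l -` U)" "0 \<in> l -` U"
    using open_vimage[OF _ smooth_on_continuous[OF l]] by auto
  then obtain \<epsilon> where \<epsilon>: "\<epsilon> > 0" "ball 0 \<epsilon> \<subseteq> l -` U"
    using open_contains_ball by blast
  have lU: "l t \<in> U" if "t \<in> {-\<epsilon><..<\<epsilon>}" for t
    using \<epsilon>(2) that by (auto simp: dist_real_def subset_eq)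
  have lr: "l t \<in> range_chart c" "\<psi> (\<gamma> t) \<noteq> 0" "\<gamma> t \<in> dom_chart c" "map_chart c (\<gamma> t) = l t"
    if "t \<in> {-\<epsilon><..<\<epsilon>}" for t
  proof -
    show r: "l t \<in> range_chart c" and "\<psi> (\<gamma> t) \<noteq> 0"
      using lU[OF that] unfolding U_def \<gamma>_def by auto
    show "\<gamma> t \<in> dom_chart c" "map_chart c (\<gamma> t) = l t"
      unfolding \<gamma>_def using inv_in_dom[OF c(1) r] map_inv[OF c(1) r] .
  qed
  define Y where "Y i = cutoff_const c \<psi> i" for i
  have Y: "vector_field A (Y i)" for i
    unfolding Y_def by (rule vector_field_cutoff_const[OF \<psi>(1)])
  define W where "W i = D (Y u) (Y i)" for i
  have W: "vector_field A (W i)" for i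
    unfolding W_def by (rule connection_field[OF D Y Y])
  \<comment> \<open>The sum over i of y_i' \<open>Y i\<close> + y_i D_X \<open>Y i\<close> has to
    vanish. One factor 1/\<psi> rescales \<open>Y u\<close> to the velocity of \<gamma>; the other
    comes from solving for y', as \<open>Y i\<close> is \<psi> times the i-th coordinate
    field.\<close>
  define L where "L i t = (- (inverse ((\<psi> \<circ> inv_chart c) (l t)) * inverse ((\<psi> \<circ> inv_chart c) (l t)))) *\<^sub>R
    field_in_chart A c (W i) (l t)" for i t
  have "smooth_on {-\<epsilon><..<\<epsilon>} (L i)" for i
  proof -
    have 1: "smooth_on {-\<epsilon><..<\<epsilon>} (\<lambda>t. field_in_chart A c (W i) (l t))"
      by (rule smooth_on_compose[OF _ open_range[OF c(1)] _ smooth_on_subset[OF l]])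
        (use W c lr in \<open>auto simp: vector_field_def\<close>)
    have "smooth_on {-\<epsilon><..<\<epsilon>} (\<lambda>t. (\<psi> \<circ> inv_chart c) (l t))"
      by (rule smooth_on_compose[OF _ open_range[OF c(1)] _ smooth_on_subset[OF l] s\<psi>])
        (use lr in auto)
    then have 2: "smooth_on {-\<epsilon><..<\<epsilon>} (\<lambda>t. inverse ((\<psi> \<circ> inv_chart c) (l t)))"
      by (intro smooth_on_inverse) (use lr in \<open>auto simp: \<gamma>_def\<close>)
    show ?thesis
      unfolding L_def
      by (rule smooth_on_scaleR[OF open_greaterThanLessThan
            smooth_on_linear[OF linear_uminus open_greaterThanLessThan
              smooth_on_mult[OF open_greaterThanLessThan 2 2]] 1])
  qed
  then obtain d y where d: "0 < d" "d \<le> \<epsilon>" and y: "smooth_on {-d<..<d} y" "y 0 = v"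
    and ode: "\<And>t. t \<in> {-d<..<d} \<Longrightarrow> (y has_vector_derivative (\<Sum>i\<in>Basis. (y t \<bullet> i) *\<^sub>R L i t)) (at t)"
    by (rule linear_ode[OF \<epsilon>(1), of L v]) blast
  have sub: "t \<in> {-\<epsilon><..<\<epsilon>}" if "t \<in> {-d<..<d}" for t using that d by auto
  note lr = lr[OF sub]
  define V where "V t = (\<Sum>i\<in>Basis. (y t \<bullet> i) *\<^sub>R Y i (\<gamma> t))" for t
  have curve: "smooth_curve A {-d<..<d} \<gamma>"
    unfolding smooth_curve_def
  proof (intro conjI ballI)
    show cont: "continuous_on {-d<..<d} \<gamma>"
      unfolding \<gamma>_def
      by (rule continuous_on_compose2[OF continuous_inv[OF c(1)]
            continuous_on_subset[OF smooth_on_continuous[OF l]]]) (use lr in auto)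
    fix e assume e: "e \<in> A"
    let ?S = "{t \<in> {-d<..<d}. \<gamma> t \<in> dom_chart e}"
    have "?S = {-d<..<d} \<inter> \<gamma> -` dom_chart e" by auto
    then have o: "open ?S"
      using continuous_open_preimage[OF cont _ open_dom[OF e]] by simp
    have "smooth_on ?S (\<lambda>t. transition c e (l t))"
      by (rule smooth_on_compose[OF o open_map_image[OF c(1) open_dom[OF e]] _ smooth_on_subset[OF l]
            smooth_transition[OF c(1) e]]) (use lr(3,4) in \<open>auto simp: image_iff, metis Int_iff\<close>)
    then show "smooth_on ?S (map_chart e \<circ> \<gamma>)"
      by (rule smooth_on_cong[OF o, rotated]) (simp add: transition_def \<gamma>_def)
  qed
  have vel: "velocity A \<gamma> t = from_chart A c (\<gamma> t) u" if t: "t \<in> {-d<..<d}" for t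
  proof -
    let ?e = "chart_at A (\<gamma> t)"
    have T: "(transition c ?e has_derivative
        frechet_derivative (transition c ?e) (at (map_chart c (\<gamma> t)))) (at (l t))"
      using transition_has_derivative[OF c(1) chart_at(1) lr(3)[OF t] chart_at(2)] lr(4)[OF t] by simp
    have "((\<lambda>s. transition c ?e (l s)) has_vector_derivative
        frechet_derivative (transition c ?e) (at (map_chart c (\<gamma> t))) u) (at t)"
      using has_derivative_compose[OF dl[unfolded has_vector_derivative_def] T]
      by (simp add: has_vector_derivative_def linear_scale[OF has_derivative_linear[OF T]])
    then show ?thesis
      by (simp add: velocity_def from_chart_def transition_def \<gamma>_def[abs_def] comp_def vector_derivative_at)
  qed
  have cov: "has_cov_deriv_along A D \<gamma> V t 0" if t: "t \<in> {-d<..<d}" for t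
  proof -
    obtain h where h: "bij_betw h {..<DIM('e)} (Basis :: 'e set)"
      using ex_bij_betw_nat_finite[OF finite_Basis] by (metis atLeast0LessThan)
    have re: "(\<Sum>i<DIM('e). g (h i)) = (\<Sum>i\<in>Basis. g i)" for g :: "'e \<Rightarrow> 'e"
      by (rule sum.reindex_bij_betw[OF h])
    \<comment> \<open>The extension has to equal the velocity at the single point
      \<open>\<gamma> t\<close> only, so a constant multiple of \<open>Y u\<close> serves.\<close>
    define X where "X q = inverse (\<psi> (\<gamma> t)) *\<^sub>R Y u q" for q
    note lin = linear_from_chart[OF c(1) lr(3)[OF t]]
    have dy: "((\<lambda>s. y s \<bullet> i) has_vector_derivative (\<Sum>j\<in>Basis. (y t \<bullet> j) *\<^sub>R L j t) \<bullet> i) (at t)" for i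
      using bounded_linear.has_vector_derivative[OF bounded_linear_inner_left ode[OF t]] .
    have DX: "D X (Y i) (\<gamma> t) = - (\<psi> (\<gamma> t) *\<^sub>R from_chart A c (\<gamma> t) (L i t))" for i
    proof -
      have "D X (Y i) (\<gamma> t) = inverse (\<psi> (\<gamma> t)) *\<^sub>R W i (\<gamma> t)"
        unfolding X_def W_def by (rule connection_scale_left[OF D smooth_function_const Y Y])
      also have "W i (\<gamma> t) = from_chart A c (\<gamma> t) (field_in_chart A c (W i) (l t))"
        using lr[OF t] c(1) field_in_chart_map[of c "\<gamma> t" "W i"] by simp
      finally have "D X (Y i) (\<gamma> t) =
          inverse (\<psi> (\<gamma> t)) *\<^sub>R from_chart A c (\<gamma> t) (field_in_chart A c (W i) (l t))" .
      moreover have "L i t = - ((inverse (\<psi> (\<gamma> t)) * inverse (\<psi> (\<gamma> t))) *\<^sub>R field_in_chart A c (W i) (l t))"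
        by (simp add: L_def \<gamma>_def)
      ultimately show ?thesis
        using lr(2)[OF t] by (simp add: linear_scale[OF lin] linear_neg[OF lin])
    qed
    have "(\<Sum>i\<in>Basis. ((\<Sum>j\<in>Basis. (y t \<bullet> j) *\<^sub>R L j t) \<bullet> i) *\<^sub>R Y i (\<gamma> t)) =
        \<psi> (\<gamma> t) *\<^sub>R (\<Sum>i\<in>Basis. ((\<Sum>j\<in>Basis. (y t \<bullet> j) *\<^sub>R L j t) \<bullet> i) *\<^sub>R from_chart A c (\<gamma> t) i)"
      using lr(3)[OF t] by (simp add: Y_def cutoff_const_def scaleR_sum_right mult.commute)
    also have "\<dots> = \<psi> (\<gamma> t) *\<^sub>R from_chart A c (\<gamma> t) (\<Sum>j\<in>Basis. (y t \<bullet> j) *\<^sub>R L j t)"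
      by (simp only: linear_Basis_sum[OF lin, symmetric])
    also have "\<dots> = (\<Sum>i\<in>Basis. (y t \<bullet> i) *\<^sub>R - D X (Y i) (\<gamma> t))"
      by (simp add: DX linear_sum[OF lin] linear_scale[OF lin] scaleR_sum_right mult.commute)
    finally have zero: "0 = (\<Sum>i\<in>Basis. ((\<Sum>j\<in>Basis. (y t \<bullet> j) *\<^sub>R L j t) \<bullet> i) *\<^sub>R Y i (\<gamma> t)
        + (y t \<bullet> i) *\<^sub>R D X (Y i) (\<gamma> t))"
      by (simp add: sum.distrib sum_negf)
    show ?thesis
      unfolding has_cov_deriv_along_def
    proof (rule exI[of _ "DIM('e)"], rule exI[of _ "\<lambda>i s. y s \<bullet> h i"], rule exI[of _ "\<lambda>i. Y (h i)"],
        rule exI[of _ X], intro conjI)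
      show "\<forall>i<DIM('e). (\<lambda>s. y s \<bullet> h i) differentiable at t \<and> vector_field A (Y (h i))"
        using dy Y differentiableI_vector by blast
      show "vector_field A X" unfolding X_def by (intro vector_field_cmult Y)
      show "X (\<gamma> t) = velocity A \<gamma> t"
        using vel[OF t] lr[OF t] by (simp add: X_def Y_def cutoff_const_def)
      show "\<forall>\<^sub>F s in nhds t. V s = (\<Sum>i<DIM('e). (y s \<bullet> h i) *\<^sub>R Y (h i) (\<gamma> s))"
        using re[of "\<lambda>i. (y _ \<bullet> i) *\<^sub>R Y i (\<gamma> _)"] by (simp add: V_def)
      show "0 = (\<Sum>i<DIM('e). vector_derivative (\<lambda>s. y s \<bullet> h i) (at t) *\<^sub>R Y (h i) (\<gamma> t)
          + (y t \<bullet> h i) *\<^sub>R D X (Y (h i)) (\<gamma> t))"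
        using zero re[of "\<lambda>i. vector_derivative (\<lambda>s. y s \<bullet> i) (at t) *\<^sub>R Y i (\<gamma> t)
          + (y t \<bullet> i) *\<^sub>R D X (Y i) (\<gamma> t)"] by (simp add: vector_derivative_at[OF dy])
    qed
  qed
  have "smooth_field_along A {-d<..<d} \<gamma> V"
    unfolding smooth_field_along_def
  proof
    fix e assume e: "e \<in> A"
    let ?S = "{t \<in> {-d<..<d}. \<gamma> t \<in> dom_chart e}"
    have o: "open ?S" by (rule smooth_curve_open[OF curve _ e]) simp
    have "smooth_on ?S (\<lambda>t. field_in_chart A e (Y i) ((map_chart e \<circ> \<gamma>) t))" for i
      by (rule smooth_on_compose[OF o open_range[OF e], where g = "field_in_chart A e (Y i)"])
        (use e curve Y in \<open>auto simp: smooth_curve_def vector_field_def map_in_range comp_def\<close>)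
    moreover have "smooth_on ?S y" by (rule smooth_on_subset[OF y(1)]) auto
    ultimately have "smooth_on ?S (\<lambda>t. \<Sum>i\<in>Basis. (y t \<bullet> i) *\<^sub>R field_in_chart A e (Y i) ((map_chart e \<circ> \<gamma>) t))"
      by (intro smooth_on_sum smooth_on_scaleR smooth_on_inner o smooth_on_const)
    then show "smooth_on ?S (\<lambda>t. to_chart A e (\<gamma> t) (V t))"
      by (rule smooth_on_cong[OF o, rotated])
        (auto simp: V_def field_in_chart_map e linear_sum[OF linear_to_chart] linear_scale[OF linear_to_chart])
  qed
  then have "parallel_along A D {-d<..<d} \<gamma> V"
    using cov by (simp add: parallel_along_def)
  moreover have g0: "\<gamma> 0 = p" using c by (simp add: \<gamma>_def l_def inv_map)
  moreover have "velocity A \<gamma> 0 = u"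
    using vel[of 0] d g0 by (simp add: c_def)
  moreover have "V 0 = v"
    using c(2) \<psi>(2) by (simp add: V_def g0 y Y_def cutoff_const_def euclidean_representation)
      (simp add: c_def euclidean_representation)
  ultimately show ?thesis using that d(1) curve by blast
qed

lemma metric_defect_add:
  assumes D: "linear_connection A D" and \<alpha>: "riemannian_metric A \<alpha>"
    and X: "vector_field A X" and Z: "vector_field A Z" and Y: "vector_field A Y" "vector_field A Y'"
  shows "metric_defect D \<alpha> X (\<lambda>q. Y q + Y' q) Z p = metric_defect D \<alpha> X Y Z p + metric_defect D \<alpha> X Y' Z p"
  using form_defect_add[OF D smooth_form_metric[OF \<alpha> Z] X Y]
  by (simp add: form_defect_metric[OF D] linear_add[OF metric_linear(2)[OF \<alpha>]])

text \<open>For a parallel field w = 0, so the product rules leave only the defects, which are then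
  derivatives of constant functions. Velocity and value of the parallel field at p can be prescribed
  as \<open>X p\<close> and \<open>Y p\<close>, so every argument is reached.\<close>

lemma compatible_imp_parallel:
  assumes D: "linear_connection A D" and comp: "compatible A (randers \<alpha> \<beta>) D"
    and \<alpha>: "riemannian_metric A \<alpha>" and \<beta>: "one_form A \<beta>"
    and X: "vector_field A X"
  shows "vector_field A Y \<Longrightarrow> form_defect D \<beta> X Y p = 0"
    and "vector_field A Y \<Longrightarrow> vector_field A Z \<Longrightarrow> metric_defect D \<alpha> X Y Z p = 0"
proof -
  have main: "form_defect D \<beta> X Y p = 0" "metric_defect D \<alpha> X Y Y p = 0" if Y: "vector_field A Y" for Y
  proof -
    obtain d \<gamma> V where d: "0 < d" and \<gamma>: "smooth_curve A {-d<..<d} \<gamma>" "\<gamma> 0 = p" "velocity A \<gamma> 0 = X p"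
      and V: "parallel_along A D {-d<..<d} \<gamma> V" "V 0 = Y p"
      using exists_parallel_field[OF D, of p "X p" "Y p"] by metis
    have cov: "has_cov_deriv_along A D \<gamma> V 0 0" using V(1) d by (simp add: parallel_along_def)
    have lin: "linear (\<beta> q)" for q using \<beta> by (simp add: one_form_def)
    have const: "randers \<alpha> \<beta> (\<gamma> t) (V' t) = randers \<alpha> \<beta> (\<gamma> 0) (V' 0)"
      if "parallel_along A D {-d<..<d} \<gamma> V'" "t \<in> {-d<..<d}" for V' t
      using comp \<gamma>(1) that d unfolding compatible_def parallel_transport_def
      by (metis greaterThanLessThan_iff neg_less_0_iff_less)
    have eqs: "sqrt (\<alpha> (\<gamma> t) (V t) (V t)) + \<beta> (\<gamma> t) (V t) = sqrt (\<alpha> p (Y p) (Y p)) + \<beta> p (Y p)"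
      "sqrt (\<alpha> (\<gamma> t) (V t) (V t)) - \<beta> (\<gamma> t) (V t) = sqrt (\<alpha> p (Y p) (Y p)) - \<beta> p (Y p)"
      if "t \<in> {-d<..<d}" for t
      using const[OF V(1) that] const[OF parallel_along_minus[OF V(1) _ \<gamma>(1)] that] \<gamma>(2) V(2)
      by (simp_all add: randers_def linear_neg[OF lin] linear_neg[OF metric_linear(1)[OF \<alpha>]]
          linear_neg[OF metric_linear(2)[OF \<alpha>]])
    have b: "\<beta> (\<gamma> t) (V t) = \<beta> p (Y p)" and a: "\<alpha> (\<gamma> t) (V t) (V t) = \<alpha> p (Y p) (Y p)"
      if "t \<in> {-d<..<d}" for t
    proof -
      have "sqrt (\<alpha> (\<gamma> t) (V t) (V t)) = sqrt (\<alpha> p (Y p) (Y p))" using eqs[OF that] by linarith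
      then show "\<alpha> (\<gamma> t) (V t) (V t) = \<alpha> p (Y p) (Y p)" by simp
    qed (use eqs[OF that] in linarith)
    have z: "0 = r" if "(g has_real_derivative r) (at 0)" "\<And>t. t \<in> {-d<..<d} \<Longrightarrow> g t = k" for g r k
    proof -
      have "(g has_real_derivative 0) (at 0)"
        by (rule has_field_derivative_transform_within_open[OF DERIV_const, of "{-d<..<d}"])
          (use that d in auto)
      then show ?thesis using that(1) DERIV_unique by blast
    qed
    have V0: "X (\<gamma> 0) = velocity A \<gamma> 0" "Y (\<gamma> 0) = V 0" using \<gamma> V by simp_all
    show "form_defect D \<beta> X Y p = 0"
      using z[OF form_along_curve[OF D smooth_form_one_form[OF \<beta>] \<gamma>(1) _ _ cov X V0(1) Y V0(2)] b] d \<gamma>(2)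
      by (simp add: linear_0[OF lin])
    show "metric_defect D \<alpha> X Y Y p = 0"
      using z[OF metric_along_curve[OF D \<alpha> \<gamma>(1) _ _ cov X V0(1) Y V0(2)] a] d \<gamma>(2)
      by (simp add: linear_0[OF metric_linear(2)[OF \<alpha>]])
  qed
  then show "vector_field A Y \<Longrightarrow> form_defect D \<beta> X Y p = 0" by blast
  assume Y: "vector_field A Y" and Z: "vector_field A Z"
  \<comment> \<open>Polarization: along a single field V only the diagonal of the metric defect is
    visible.\<close>
  have "0 = metric_defect D \<alpha> X (\<lambda>q. Y q + Z q) (\<lambda>q. Y q + Z q) p"
    using main(2)[OF vector_field_add[OF Y Z]] by simp
  also have "\<dots> = metric_defect D \<alpha> X Y (\<lambda>q. Y q + Z q) p + metric_defect D \<alpha> X Z (\<lambda>q. Y q + Z q) p"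
    by (intro metric_defect_add[OF D \<alpha> X] vector_field_add Y Z)
  also have "\<dots> = 2 * metric_defect D \<alpha> X Y Z p"
    using metric_defect_add[OF D \<alpha> X _ Y Z] main(2) Y Z
    by (simp add: metric_defect_commute[OF D \<alpha>, of X _ "\<lambda>q. Y q + Z q"] metric_defect_commute[OF D \<alpha>, of X Z Y])
  finally show "metric_defect D \<alpha> X Y Z p = 0" by simp
qed

text \<open>The same product rules read backwards: at every time r, arbitrary extensions of the
  velocity and of \<open>V r\<close> show that \<beta>(V) and \<alpha>(V, V) have derivative
  0.\<close>

lemma parallel_imp_compatible:
  assumes D: "linear_connection A D" and \<alpha>: "riemannian_metric A \<alpha>" and \<beta>: "one_form A \<beta>"
    and db: "\<And>X Y p. vector_field A X \<Longrightarrow> vector_field A Y \<Longrightarrow> form_defect D \<beta> X Y p = 0"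
    and da: "\<And>X Y p. vector_field A X \<Longrightarrow> vector_field A Y \<Longrightarrow> metric_defect D \<alpha> X Y Y p = 0"
  shows "compatible A (randers \<alpha> \<beta>) D"
  unfolding compatible_def
proof (intro allI impI)
  fix a b :: real and \<gamma> s t v w
  assume \<gamma>: "smooth_curve A {a<..<b} \<gamma>" and s: "s \<in> {a<..<b}" and t: "t \<in> {a<..<b}"
    and "parallel_transport A D {a<..<b} \<gamma> s t v w"
  then obtain V where V: "\<And>r. r \<in> {a<..<b} \<Longrightarrow> has_cov_deriv_along A D \<gamma> V r 0" "V s = v" "V t = w"
    unfolding parallel_transport_def parallel_along_def by blast
  have lin: "linear (\<beta> q)" for q using \<beta> by (simp add: one_form_def)
  have "((\<lambda>s. \<beta> (\<gamma> s) (V s)) has_real_derivative 0) (at r)"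
    "((\<lambda>s. \<alpha> (\<gamma> s) (V s) (V s)) has_real_derivative 0) (at r)" if r: "r \<in> {a<..<b}" for r
    using form_along_curve[OF D smooth_form_one_form[OF \<beta>] \<gamma> _ r V(1)[OF r] extend_vector extend_vector]
      metric_along_curve[OF D \<alpha> \<gamma> _ r V(1)[OF r] extend_vector extend_vector]
    by (simp_all add: db da extend_vector linear_0[OF lin] linear_0[OF metric_linear(2)[OF \<alpha>]])
  then have "\<beta> (\<gamma> t) (V t) = \<beta> (\<gamma> s) (V s)" "\<alpha> (\<gamma> t) (V t) (V t) = \<alpha> (\<gamma> s) (V s) (V s)"
    using has_field_derivative_zero_constant[of "{a<..<b}" "\<lambda>s. \<beta> (\<gamma> s) (V s)"]
      has_field_derivative_zero_constant[of "{a<..<b}" "\<lambda>s. \<alpha> (\<gamma> s) (V s) (V s)"] s t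
      has_field_derivative_at_within by (metis convex_real_interval(8))+
  then show "randers \<alpha> \<beta> (\<gamma> t) w = randers \<alpha> \<beta> (\<gamma> s) v"
    using V(2,3) by (simp add: randers_def)
qed

end

section \<open>Linear algebra of the minimization\<close>

text \<open>This models \<alpha> on a single tangent space; the minimization and the torsion formula
  are pure algebra there.\<close>

locale inner_form =
  fixes g :: "'e::euclidean_space \<Rightarrow> 'e \<Rightarrow> real"
  assumes bilinear: "bilinear g" and commute: "g u v = g v u"
begin

lemmas simps = bilinear_ladd[OF bilinear] bilinear_radd[OF bilinear] bilinear_lmul[OF bilinear]
  bilinear_rmul[OF bilinear] bilinear_lsub[OF bilinear] bilinear_rsub[OF bilinear]
  bilinear_lneg[OF bilinear] bilinear_rneg[OF bilinear] bilinear_lzero[OF bilinear]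
  bilinear_rzero[OF bilinear]

lemma linear_left: "linear (\<lambda>u. g u v)" and linear_right: "linear (g u)"
  using bilinear by (auto simp: bilinear_def)

lemma orthonormal_expansion:
  assumes E: "independent E" "span E = UNIV" "\<And>u v. u \<in> E \<Longrightarrow> v \<in> E \<Longrightarrow> g u v = (if u = v then 1 else 0)"
  shows "w \<in> E \<Longrightarrow> representation E x w = g x w" and "(\<Sum>e\<in>E. g x e *\<^sub>R e) = x"
proof -
  have fin: "finite E" using E(1) by (rule independent_imp_finite)
  have x: "(\<Sum>e\<in>E. representation E x e *\<^sub>R e) = x" for x
    by (rule sum_representation_eq) (use E fin in auto)
  have r: "representation E x w = g x w" if w: "w \<in> E" for w
  proof -
    have "g x w = (\<Sum>e\<in>E. representation E x e * g e w)"
      by (subst x[symmetric]) (simp add: linear_sum[OF linear_left] simps)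
    also have "\<dots> = (\<Sum>e\<in>E. if e = w then representation E x e else 0)"
      by (rule sum.cong) (use E(3) w in auto)
    finally show ?thesis using fin w by simp
  qed
  then show "w \<in> E \<Longrightarrow> representation E x w = g x w" .
  show "(\<Sum>e\<in>E. g x e *\<^sub>R e) = x"
    using x[of x] r by (simp cong: sum.cong)
qed

text \<open>Gram-Schmidt: as long as an orthonormal system has fewer than \<open>DIM('e)\<close>
  elements, some vector lies outside its span, and its normalized residual is added.\<close>

lemma exists_orthonormal:
  assumes pos: "\<And>u. u \<noteq> 0 \<Longrightarrow> g u u > 0"
  shows "\<exists>E. independent E \<and> span E = UNIV \<and> (\<forall>u\<in>E. \<forall>v\<in>E. g u v = (if u = v then 1 else 0))"
proof -
  have "\<exists>E. finite E \<and> card E = n \<and> independent E \<and> (\<forall>u\<in>E. \<forall>v\<in>E. g u v = (if u = v then 1 else 0))"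
    if "n \<le> DIM('e)" for n
    using that
  proof (induction n)
    case 0
    show ?case by (rule exI[of _ "{}"]) (auto simp: independent_empty)
  next
    case (Suc n)
    then obtain E where E: "finite E" "card E = n" "independent E"
      "\<And>u v. u \<in> E \<Longrightarrow> v \<in> E \<Longrightarrow> g u v = (if u = v then 1 else 0)" by auto
    have "span E \<noteq> UNIV"
      using dim_eq_card_independent[OF E(3)] E(2) Suc.prems
      by (metis dim_UNIV dim_span not_less_eq_eq order_refl)
    then obtain x where x: "x \<notin> span E" by auto
    define y where "y = x - (\<Sum>e\<in>E. g x e *\<^sub>R e)"
    have S: "(\<Sum>e\<in>E. g x e *\<^sub>R e) \<in> span E"
      by (intro span_sum span_scale span_base)
    have y0: "y \<notin> span E"
      using x S unfolding y_def by (metis diff_add_cancel span_add)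
    then have "y \<noteq> 0" using span_0 by metis
    then have gy: "g y y > 0" by (rule pos)
    have ye: "g y e = 0" if e: "e \<in> E" for e
    proof -
      have "g (\<Sum>a\<in>E. g x a *\<^sub>R a) e = (\<Sum>a\<in>E. if a = e then g x a else 0)"
        unfolding linear_sum[OF linear_left] by (rule sum.cong) (use E(4) e in \<open>auto simp: simps\<close>)
      then show ?thesis using e E(1) by (simp add: y_def simps)
    qed
    define z where "z = inverse (sqrt (g y y)) *\<^sub>R y"
    have ze: "g z e = 0" if "e \<in> E" for e
      using ye[OF that] by (simp add: z_def simps)
    have "g z z = g y y / (sqrt (g y y) * sqrt (g y y))"
      by (simp add: z_def simps divide_inverse del: real_sqrt_mult_self)
    then have "g z z = 1" using gy by simp
    with ze have z: "g z z = 1" "\<And>e. e \<in> E \<Longrightarrow> g z e = 0" "\<And>e. e \<in> E \<Longrightarrow> g e z = 0"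
      using commute by metis+
    have zs: "z \<notin> span E"
    proof
      assume "z \<in> span E"
      then have "sqrt (g y y) *\<^sub>R z \<in> span E" by (rule span_scale)
      then show False using y0 gy by (simp add: z_def)
    qed
    have "z \<notin> E" using zs span_base by blast
    then show ?case
      using E z zs by (intro exI[of _ "insert z E"]) (auto simp: independent_insert)
  qed
  from this[of "DIM('e)"] obtain E where E: "finite E" "card E = DIM('e)" "independent E"
    "\<forall>u\<in>E. \<forall>v\<in>E. g u v = (if u = v then 1 else 0)" by auto
  have "span E = UNIV"
    using card_ge_dim_independent[of E UNIV] E by (auto simp: dim_UNIV)
  then show ?thesis using E by blast
qed

section \<open>Traces over an orthonormal basis and the first variation\<close>

context
  fixes E
  assumes E: "independent E" "span E = UNIV" "\<And>u v. u \<in> E \<Longrightarrow> v \<in> E \<Longrightarrow> g u v = (if u = v then 1 else 0)"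
begin

text \<open>Contraction with g(_, x) over E inserts x into f. This evaluates the double sums of the
  first variation at a, b and c.\<close>

lemma sum_orthonormal_linear:
  fixes f :: "'e \<Rightarrow> real"
  assumes "linear f"
  shows "(\<Sum>e\<in>E. g e x * f e) = f x"
proof -
  have "f x = f (\<Sum>e\<in>E. g x e *\<^sub>R e)" using orthonormal_expansion(2)[OF E] by simp
  also have "\<dots> = (\<Sum>e\<in>E. g e x * f e)"
    by (simp add: linear_sum[OF assms] linear_scale[OF assms] commute[of x])
  finally show ?thesis by simp
qed

lemma parseval: "(\<Sum>e\<in>E. (representation E x e)\<^sup>2) = g x x"
proof -
  have "(\<Sum>e\<in>E. (representation E x e)\<^sup>2) = (\<Sum>e\<in>E. g e x * g x e)"
    using orthonormal_expansion(1)[OF E] commute by (intro sum.cong) (auto simp: power2_eq_square)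
  then show ?thesis using sum_orthonormal_linear[OF linear_right] by simp
qed

text \<open>The first variation of the squared norm of \<open>T\<close> in the direction of the alternation of
  \<open>S(u, v) = g(u, a) (g(v, b) c - g(v, c) b)\<close> is \<open>4 (g(T(a, b), c) - g(T(a, c), b))\<close>.\<close>

lemma minimal_imp_symmetric:
  fixes T :: "'e \<Rightarrow> 'e \<Rightarrow> 'e"
  assumes pos: "\<And>u. g u u \<ge> 0"
    and T: "bilinear T" "\<And>u v. T u v = - T v u"
    and S: "\<And>u v. S u v = g u a *\<^sub>R (g v b *\<^sub>R c - g v c *\<^sub>R b)"
    and min: "\<And>r. (\<Sum>u\<in>E. \<Sum>v\<in>E. g (T u v) (T u v)) \<le>
      (\<Sum>u\<in>E. \<Sum>v\<in>E. g (T u v + r *\<^sub>R (S u v - S v u)) (T u v + r *\<^sub>R (S u v - S v u)))"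
  shows "g (T a b) c = g (T a c) b"
proof -
  define q where "q = (\<Sum>u\<in>E. \<Sum>v\<in>E. g (T u v) (S u v))"
  define s where "s = (\<Sum>u\<in>E. \<Sum>v\<in>E. g (S u v - S v u) (S u v - S v u))"
  have lT: "linear (\<lambda>v. g (T u v) w)" "linear (\<lambda>v. g (T v u) w)" for u w
    using linear_compose[of "T u" "\<lambda>v. g v w"] linear_compose[of "\<lambda>v. T v u" "\<lambda>v. g v w"] T(1) linear_left
    by (auto simp: bilinear_def comp_def)
  have "q = (\<Sum>u\<in>E. g u a * ((\<Sum>v\<in>E. g v b * g (T u v) c) - (\<Sum>v\<in>E. g v c * g (T u v) b)))"
    unfolding q_def by (simp add: S simps sum_subtractf[symmetric] sum_distrib_left algebra_simps)
  also have "\<dots> = (\<Sum>u\<in>E. g u a * (g (T u b) c - g (T u c) b))"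
    by (simp add: sum_orthonormal_linear lT)
  also have "\<dots> = g (T a b) c - g (T a c) b"
    by (rule sum_orthonormal_linear) (intro linear_compose_sub lT)
  finally have q: "q = g (T a b) c - g (T a c) b" .
  \<comment> \<open>Antisymmetry of T: the two halves of the alternation of S contribute equally,
    which doubles the linear coefficient 2 q to 4 q.\<close>
  have "(\<Sum>u\<in>E. \<Sum>v\<in>E. g (T u v) (S v u)) = (\<Sum>u\<in>E. \<Sum>v\<in>E. g (T v u) (S u v))"
    by (rule sum.swap)
  also have "\<dots> = - q"
    unfolding q_def by (subst T(2)) (simp add: simps sum_negf)
  finally have q': "(\<Sum>u\<in>E. \<Sum>v\<in>E. g (T u v) (S v u)) = - q" .
  have "0 \<le> 4 * r * q + r\<^sup>2 * s" for r
  proof -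
    have "g (T u v + r *\<^sub>R (S u v - S v u)) (T u v + r *\<^sub>R (S u v - S v u)) =
        g (T u v) (T u v) + 2 * r * g (T u v) (S u v) - 2 * r * g (T u v) (S v u)
        + r\<^sup>2 * g (S u v - S v u) (S u v - S v u)" for u v
      using commute[of "S u v" "T u v"] commute[of "S v u" "T u v"]
      by (simp add: simps algebra_simps power2_eq_square)
    then have "(\<Sum>u\<in>E. \<Sum>v\<in>E. g (T u v + r *\<^sub>R (S u v - S v u)) (T u v + r *\<^sub>R (S u v - S v u))) =
        (\<Sum>u\<in>E. \<Sum>v\<in>E. g (T u v) (T u v)) + 2 * r * q - 2 * r * (- q) + r\<^sup>2 * s"
      unfolding q'[symmetric] unfolding q_def s_def
      by (simp only: sum.distrib sum_subtractf sum_distrib_left)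
    then show ?thesis using min[of r] by (simp add: algebra_simps)
  qed
  note nonneg = this
  have s0: "s \<ge> 0" unfolding s_def by (intro sum_nonneg pos)
  \<comment> \<open>A quadratic in r that is nonnegative everywhere and vanishes at 0 has no linear
    term. The chosen r makes it negative unless q = 0; the 1 in the denominator covers the case s =
    0.\<close>
  have "0 \<le> 4 * (- (q / (s + 1))) * q + (- (q / (s + 1)))\<^sup>2 * s" by (rule nonneg)
  also have "\<dots> = - (q\<^sup>2 * (3 * s + 4)) / (s + 1)\<^sup>2"
  proof -
    have "s + 1 \<noteq> 0" using s0 by simp
    then show ?thesis by (simp add: divide_simps power2_eq_square) (simp add: algebra_simps)
  qed
  finally have "q\<^sup>2 * (3 * s + 4) / (s + 1)\<^sup>2 \<le> 0" by simp
  then have "q\<^sup>2 * (3 * s + 4) \<le> 0" using s0 by (simp add: divide_le_0_iff)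
  then have "q = 0" using s0 by (smt (verit) mult_pos_pos zero_less_power2)
  then show ?thesis using q by simp
qed

end

text \<open>The difference \<open>H\<close> from the Levi-Civita connection splits along \<open>b\<close> and its orthogonal
  complement. The symmetry kills the part of \<open>H\<close> in the complement, since there \<open>H\<close> equals minus the
  cyclic sum of \<open>H\<close>; the rest is determined by \<open>n = - H(_, b)\<close>.\<close>

lemma extremal_torsion_formula:
  fixes H :: "'e \<Rightarrow> 'e \<Rightarrow> 'e"
  assumes H: "bilinear H" and skew: "\<And>u v w. g (H u v) w = - g (H u w) v"
    and b: "g b b = K\<^sup>2" "K \<noteq> 0" and n: "\<And>u. H u b = - n u"
    and sym: "\<And>u v w. g v b = 0 \<Longrightarrow> g w b = 0 \<Longrightarrow> g (H u v - H v u) w = g (H u w - H w u) v"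
  shows "g (H x y - H y x) z =
    g ((g (n x) y / K\<^sup>2) *\<^sub>R b - (g y b / K\<^sup>2) *\<^sub>R n x - (g (n y) x / K\<^sup>2) *\<^sub>R b + (g x b / K\<^sup>2) *\<^sub>R n y) z
    + (g b y * (g (n x) z - g (n z) x) - g b x * (g (n y) z - g (n z) y)) / (2 * K\<^sup>2)
    + (g b x * (g (n y) b - g (n b) y) - g b y * (g (n x) b - g (n b) x)) / (2 * K ^ 4) * g b z"
proof -
  define k where "k = K\<^sup>2"
  have k: "k \<noteq> 0" "g b b = k" "K ^ 4 = k * k" using b by (auto simp: k_def power4_eq_xxxx power2_eq_square)
  note Hs = bilinear_ladd[OF H] bilinear_radd[OF H] bilinear_lmul[OF H] bilinear_rmul[OF H]
    bilinear_lsub[OF H] bilinear_rsub[OF H]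
  have hb: "g (H u b) w = - g (n u) w" "g (H u w) b = g (n u) w" for u w
    using skew[of u w b] by (simp_all add: n simps)
  have nb: "g (n u) b = 0" for u
    using skew[of u b b] by (simp add: n simps)
  have n_eq: "n u = - H u b" for u by (simp add: n)
  define P where "P v = v - (g v b / k) *\<^sub>R b" for v
  have Pb: "g (P v) b = 0" for v using k by (simp add: P_def simps)
  have Hbb: "g (H u b) b = 0" for u using skew[of u b b] by simp
  \<comment> \<open>Both v and w are split along b. The component with b in both places vanishes,
    and those with b in one place are given by n.\<close>
  have F1: "g (H u v) w = g (H u (P v)) (P w) - (g v b / k) * g (n u) w + (g w b / k) * g (n u) v" for u v w
    by (simp add: P_def Hs simps hb nb)
  \<comment> \<open>Adding the three cyclic instances gives c = -3 c for the cyclic sum c; thus c =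
    0, and H vanishes with it.\<close>
  have F2: "g (H (P u) (P v)) (P w) = 0" for u v w
    using sym[OF Pb Pb, of "P u" v w] sym[OF Pb Pb, of "P v" w u] sym[OF Pb Pb, of "P w" u v]
      skew[of "P u" "P v" "P w"] skew[of "P v" "P u" "P w"] skew[of "P w" "P u" "P v"]
    by (simp add: simps)
  \<comment> \<open>In the symmetry with u = b, skewness makes the two terms in \<open>H b\<close>
    add up instead of cancelling, whence the division by 2.\<close>
  have F3: "g (H b (P v)) (P w) = (g (n (P w)) (P v) - g (n (P v)) (P w)) / 2" for v w
    using sym[OF Pb Pb, of b v w] skew[of b "P v" "P w"] by (simp add: simps n)
  \<comment> \<open>The projection of v is invisible because n takes values orthogonal to b, but
    that of w leaves a term in \<open>n b\<close>. Together with the factor 1/k of \<open>F5\<close>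
    it becomes the K^4 term.\<close>
  have F4: "g (n (P w)) (P v) = g (n w) v - (g w b / k) * g (n b) v" for v w
    unfolding n_eq by (simp add: P_def Hs simps Hbb)
  have F5: "g (H u (P v)) (P w) = (g u b / k) *
      ((g (n w) v - (g w b / k) * g (n b) v - g (n v) w + (g v b / k) * g (n b) w) / 2)" for u v w
  proof -
    have "u = P u + (g u b / k) *\<^sub>R b" by (simp add: P_def)
    then have "g (H u (P v)) (P w) = g (H (P u + (g u b / k) *\<^sub>R b) (P v)) (P w)" by simp
    also have "\<dots> = (g u b / k) * g (H b (P v)) (P w)" by (simp add: Hs simps F2)
    finally show ?thesis unfolding F3 F4 by (simp add: algebra_simps)
  qed
  have L: "g (H x y - H y x) z = g (H x y) z - g (H y x) z" by (simp add: simps)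
  show ?thesis
    unfolding L F1[of x y z] F1[of y x z] F5 k_def[symmetric] k(3)
    using k(1) by (simp add: simps nb commute[of b] field_simps)
qed

end

section \<open>Variation of compatible connections\<close>

lemma inner_form_metric: "riemannian_metric A \<alpha> \<Longrightarrow> inner_form (\<alpha> p)"
  by (auto simp: riemannian_metric_def inner_form_def)

context smooth_manifold
begin

lemma orthonormal_basis_some:
  assumes "riemannian_metric A \<alpha>"
  shows "orthonormal_basis \<alpha> p (SOME E. orthonormal_basis \<alpha> p E)"
proof -
  have "\<exists>E. orthonormal_basis \<alpha> p E"
    using inner_form.exists_orthonormal[OF inner_form_metric[OF assms], of p] metric_linear(5)[OF assms]
    unfolding orthonormal_basis_def by blast
  then show ?thesis by (rule someI_ex)
qed

text \<open>The chosen basis depends on \<alpha> and p but not on D, so two connections are compared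
  by sums over one and the same basis.\<close>

lemma torsion_norm_sq_eq:
  assumes "riemannian_metric A \<alpha>"
  shows "torsion_norm_sq A \<alpha> D p = (\<Sum>u\<in>(SOME E. orthonormal_basis \<alpha> p E).
    \<Sum>v\<in>(SOME E. orthonormal_basis \<alpha> p E). \<alpha> p (torsion_at A D p u v) (torsion_at A D p u v))"
  using orthonormal_basis_some[OF assms, of p] inner_form.parseval[OF inner_form_metric[OF assms]]
  unfolding torsion_norm_sq_def Let_def orthonormal_basis_def by (intro sum.cong refl) blast

text \<open>Y is subjected to an infinitesimal rotation in the plane of V and W, with speed r
  \<alpha>(X, U). Such a rotation preserves \<alpha>, and it annihilates B if the plane is
  orthogonal to B.\<close>

definition vary :: "('m \<Rightarrow> 'e \<Rightarrow> 'e \<Rightarrow> real) \<Rightarrow> ('m \<Rightarrow> 'e) \<Rightarrow> ('m \<Rightarrow> 'e) \<Rightarrow> ('m \<Rightarrow> 'e) \<Rightarrow>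
    ('m, 'e) connection \<Rightarrow> real \<Rightarrow> ('m, 'e) connection" where
  "vary \<alpha> U V W D r X Y q = D X Y q +
     (r * \<alpha> q (X q) (U q)) *\<^sub>R (\<alpha> q (Y q) (V q) *\<^sub>R W q - \<alpha> q (Y q) (W q) *\<^sub>R V q)"

lemma linear_connection_vary:
  assumes D: "linear_connection A D" and \<alpha>: "riemannian_metric A \<alpha>"
    and U: "vector_field A U" and V: "vector_field A V" and W: "vector_field A W"
  shows "linear_connection A (vary \<alpha> U V W D r)"
proof -
  have field: "vector_field A (vary \<alpha> U V W D r X Y)" if X: "vector_field A X" and Y: "vector_field A Y" for X Y
  proof -
    have "vector_field A (\<lambda>q. D X Y q + (r * \<alpha> q (X q) (U q)) *\<^sub>R
        (\<alpha> q (Y q) (V q) *\<^sub>R W q + (-1 * \<alpha> q (Y q) (W q)) *\<^sub>R V q))"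
      using connection_field[OF D X Y] X Y U V W
      by (intro vector_field_add vector_field_scale smooth_function_mult smooth_function_metric[OF \<alpha>]
          smooth_function_const) simp_all
    then show ?thesis
      by (rule back_subst[of "vector_field A"]) (simp add: vary_def fun_eq_iff)
  qed
  note s = inner_form.simps[OF inner_form_metric[OF \<alpha>]]
  show ?thesis
    unfolding linear_connection_def
    using field connection_add_left[OF D] connection_add_right[OF D] connection_scale_left[OF D]
      connection_scale_right[OF D]
    by (auto simp: vary_def fun_eq_iff s algebra_simps)
qed

text \<open>The added values are combinations of V and W, on which \<beta> vanishes, and their
  \<alpha>-product with Y is 0 by skewness; so neither defect changes.\<close>

lemma compatible_vary:
  assumes D: "linear_connection A D" and comp: "compatible A (randers \<alpha> \<beta>) D"
    and \<alpha>: "riemannian_metric A \<alpha>" and \<beta>: "one_form A \<beta>"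
    and U: "vector_field A U" and V: "vector_field A V" and W: "vector_field A W"
    and orth: "\<And>q. \<beta> q (V q) = 0" "\<And>q. \<beta> q (W q) = 0"
  shows "compatible A (randers \<alpha> \<beta>) (vary \<alpha> U V W D r)"
proof (rule parallel_imp_compatible[OF linear_connection_vary[OF D \<alpha> U V W] \<alpha> \<beta>])
  fix X Y p assume X: "vector_field A X" and Y: "vector_field A Y"
  note s = inner_form.simps[OF inner_form_metric[OF \<alpha>]]
  have lin: "linear (\<beta> p)" using \<beta> by (simp add: one_form_def)
  show "form_defect (vary \<alpha> U V W D r) \<beta> X Y p = 0"
    using compatible_imp_parallel(1)[OF D comp \<alpha> \<beta> X Y]
    by (simp add: form_defect_def vary_def linear_add[OF lin] linear_scale[OF lin] linear_diff[OF lin] orth)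
  show "metric_defect (vary \<alpha> U V W D r) \<alpha> X Y Y p = 0"
    using compatible_imp_parallel(2)[OF D comp \<alpha> \<beta> X Y Y, of p] metric_linear(3)[OF \<alpha>, of p]
    by (simp add: metric_defect_def vary_def s algebra_simps)
qed

lemma torsion_vary:
  "torsion A (vary \<alpha> U V W D r) X Y p = torsion A D X Y p + r *\<^sub>R
    (\<alpha> p (X p) (U p) *\<^sub>R (\<alpha> p (Y p) (V p) *\<^sub>R W p - \<alpha> p (Y p) (W p) *\<^sub>R V p)
    - \<alpha> p (Y p) (U p) *\<^sub>R (\<alpha> p (X p) (V p) *\<^sub>R W p - \<alpha> p (X p) (W p) *\<^sub>R V p))"
  by (simp add: torsion_def vary_def algebra_simps)

section \<open>The difference tensor of two connections\<close>

definition difference_at :: "('m, 'e) connection \<Rightarrow> ('m, 'e) connection \<Rightarrow> 'm \<Rightarrow> 'e \<Rightarrow> 'e \<Rightarrow> 'e" where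
  "difference_at D N p u v =
     D (extend_vector A p u) (extend_vector A p v) p - N (extend_vector A p u) (extend_vector A p v) p"

context
  fixes D N
  assumes D: "linear_connection A D" and N: "linear_connection A N"
begin

text \<open>In the second argument the Leibniz terms of D and N are identical and cancel, so
  \<open>tensorial\<close> applies there as well.\<close>

lemma difference_at:
  assumes X: "vector_field A X" and Y: "vector_field A Y"
  shows "D X Y p - N X Y p = difference_at D N p (X p) (Y p)"
proof -
  let ?X = "extend_vector A p (X p)" and ?Y = "extend_vector A p (Y p)"
  have "D X Y p - N X Y p = D ?X Y p - N ?X Y p"
    using connection_cong_left[OF D X _ Y] connection_cong_left[OF N X _ Y] extend_vector by metis
  also have "\<dots> = D ?X ?Y p - N ?X ?Y p"
    by (rule tensorial[where p = p and G = "\<lambda>Y. D ?X Y p - N ?X Y p"])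
      (auto simp: extend_vector Y connection_add_right[OF D] connection_add_right[OF N]
        connection_scale_right[OF D] connection_scale_right[OF N] algebra_simps)
  finally show ?thesis by (simp add: difference_at_def)
qed

text \<open>\<open>extend_vector\<close> is an arbitrary choice and need not be additive. Sums and
  multiples of extensions are, however, extensions of the sums and multiples, and the value does not
  depend on the extension.\<close>

lemma bilinear_difference_at: "bilinear (difference_at D N p)"
proof -
  let ?e = "extend_vector A p"
  have "difference_at D N p (u + u') v = difference_at D N p u v + difference_at D N p u' v" for u u' v
    using difference_at[OF vector_field_add[OF extend_vector(1)[of p u] extend_vector(1)[of p u']]
        extend_vector(1)[of p v], of p]
    by (simp add: extend_vector connection_add_left[OF D] connection_add_left[OF N] difference_at_def
        algebra_simps)
  moreover have "difference_at D N p (r *\<^sub>R u) v = r *\<^sub>R difference_at D N p u v" for r u v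
    using difference_at[OF vector_field_cmult[OF extend_vector(1)[of p u]] extend_vector(1)[of p v], of r p]
    by (simp add: extend_vector connection_scale_left[OF D smooth_function_const]
        connection_scale_left[OF N smooth_function_const] difference_at_def algebra_simps)
  moreover have "difference_at D N p u (v + v') = difference_at D N p u v + difference_at D N p u v'" for u v v'
    using difference_at[OF extend_vector(1)[of p u]
        vector_field_add[OF extend_vector(1)[of p v] extend_vector(1)[of p v']], of p]
    by (simp add: extend_vector connection_add_right[OF D] connection_add_right[OF N] difference_at_def
        algebra_simps)
  moreover have "difference_at D N p u (r *\<^sub>R v) = r *\<^sub>R difference_at D N p u v" for r u v
    using difference_at[OF extend_vector(1)[of p u] vector_field_cmult[OF extend_vector(1)[of p v]], of r p]
    by (simp add: extend_vector connection_scale_right[OF D smooth_function_const]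
        connection_scale_right[OF N smooth_function_const] difference_at_def algebra_simps)
  ultimately show ?thesis by (auto simp: bilinear_def intro!: linearI)
qed

end

text \<open>Subtracting the vanishing torsion of N removes the bracket.\<close>

lemma torsion_eq_difference:
  assumes D: "linear_connection A D" and N: "levi_civita A \<alpha> N"
    and X: "vector_field A X" and Y: "vector_field A Y"
  shows "torsion A D X Y p = difference_at D N p (X p) (Y p) - difference_at D N p (Y p) (X p)"
proof -
  have lN: "linear_connection A N" and "torsion A N X Y p = 0"
    using N X Y by (auto simp: levi_civita_def)
  then show ?thesis
    using difference_at[OF D lN X Y, of p] difference_at[OF D lN Y X, of p]
    by (simp add: torsion_def algebra_simps)
qed

end

section \<open>The torsion of the extremal connection\<close>

theorem theorem5:
  fixes A :: "('m::{t2_space,second_countable_topology}, 'e::euclidean_space) chart set"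
    and \<alpha> :: "'m \<Rightarrow> 'e \<Rightarrow> 'e \<Rightarrow> real"
    and \<beta> :: "'m \<Rightarrow> 'e \<Rightarrow> real"
    and B :: "'m \<Rightarrow> 'e"
    and K :: real
    and N D :: "('m, 'e) connection"
  assumes "smooth_atlas A"
    and "connected (UNIV :: 'm set)"
    and "riemannian_metric A \<alpha>"
    and "one_form A \<beta>"
    and "dual_field A \<alpha> \<beta> B"
    and "\<And>p. \<alpha> p (B p) (B p) < 1"
    and "generalized_berwald A (randers \<alpha> \<beta>)"
    and "\<And>p. sqrt (\<alpha> p (B p) (B p)) = K"
    and "K \<noteq> 0"
    and "levi_civita A \<alpha> N"
    and "extremal_compatible_connection A \<alpha> (randers \<alpha> \<beta>) D"
  shows "\<forall>X Y Z. vector_field A X \<longrightarrow> vector_field A Y \<longrightarrow> vector_field A Z \<longrightarrow>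
    (\<forall>p. \<alpha> p (torsion A D X Y p) (Z p) =
        \<alpha> p (T_circ \<alpha> B N K X Y p) (Z p)
        + (\<beta> p (Y p) * ext_deriv A \<beta> X Z p - \<beta> p (X p) * ext_deriv A \<beta> Y Z p) / (2 * K\<^sup>2)
        + (\<beta> p (X p) * ext_deriv A \<beta> Y B p - \<beta> p (Y p) * ext_deriv A \<beta> X B p) / (2 * K ^ 4)
          * \<beta> p (Z p))"
proof (intro allI impI)
  fix X Y Z p assume X: "vector_field A X" and Y: "vector_field A Y" and Z: "vector_field A Z"
  interpret smooth_manifold A by unfold_locales fact
  note \<alpha> = \<open>riemannian_metric A \<alpha>\<close> and \<beta> = \<open>one_form A \<beta>\<close> and LC = \<open>levi_civita A \<alpha> N\<close>
  \<comment> \<open>Duality is given on fields; it holds on all tangent vectors because each one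
    extends to a field.\<close>
  have B: "vector_field A B" and dual: "\<And>q v. \<beta> q v = \<alpha> q (B q) v"
    using \<open>dual_field A \<alpha> \<beta> B\<close> extend_vector unfolding dual_field_def by metis+
  have D: "linear_connection A D" and comp: "compatible A (randers \<alpha> \<beta>) D"
    and min: "\<And>D' q. linear_connection A D' \<Longrightarrow> compatible A (randers \<alpha> \<beta>) D' \<Longrightarrow>
      torsion_norm_sq A \<alpha> D q \<le> torsion_norm_sq A \<alpha> D' q"
    using \<open>extremal_compatible_connection A \<alpha> (randers \<alpha> \<beta>) D\<close>
    by (auto simp: extremal_compatible_connection_def)
  have N: "linear_connection A N" using LC by (simp add: levi_civita_def)
  interpret g: inner_form "\<alpha> q" for q by (rule inner_form_metric[OF \<alpha>])
  have pos: "\<alpha> q u u > 0" if "u \<noteq> 0" for q u using metric_linear(5)[OF \<alpha> that] .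
  have nonneg: "\<alpha> q u u \<ge> 0" for q u
    using pos[of u q] by (cases "u = 0") (auto simp: g.simps)
  have BB: "\<alpha> q (B q) (B q) = K\<^sup>2" for q
    using assms(8)[of q] nonneg[of q "B q"] by auto

  have metricD: "dir_deriv A U (\<lambda>q. \<alpha> q (V q) (W q)) q = \<alpha> q (D U V q) (W q) + \<alpha> q (V q) (D U W q)"
    if "vector_field A U" "vector_field A V" "vector_field A W" for U V W q
    using compatible_imp_parallel(2)[OF D comp \<alpha> \<beta> that, of q] by (simp add: metric_defect_def)
  have metricN: "dir_deriv A U (\<lambda>q. \<alpha> q (V q) (W q)) q = \<alpha> q (N U V q) (W q) + \<alpha> q (V q) (N U W q)"
    if "vector_field A U" "vector_field A V" "vector_field A W" for U V W q
    using LC that by (simp add: levi_civita_def)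
  \<comment> \<open>With \<alpha> and \<beta> both parallel, D_U B is orthogonal to every field;
    testing it against an extension of its own value contradicts positivity.\<close>
  have DB: "D U B q = 0" if U: "vector_field A U" for U q
  proof (rule ccontr)
    assume "D U B q \<noteq> 0"
    let ?E = "extend_vector A q (D U B q)"
    have E: "vector_field A ?E" by (rule extend_vector)
    have "\<alpha> q (D U B q) (?E q) = 0"
      using compatible_imp_parallel(1)[OF D comp \<alpha> \<beta> U E, of q] metricD[OF U B E, of q]
      by (simp add: form_defect_def dual)
    then show False using pos[OF \<open>D U B q \<noteq> 0\<close>, of q] by (simp add: extend_vector)
  qed

  define H where "H = difference_at D N p"
  \<comment> \<open>Since D B = 0, this is u -> N_u B, written as a map on the tangent space at
    p.\<close>
  define n where "n u = - H u (B p)" for u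
  have H: "D U V p - N U V p = H (U p) (V p)" if "vector_field A U" "vector_field A V" for U V
    unfolding H_def by (rule difference_at[OF D N that])
  have T: "torsion A D U V p = H (U p) (V p) - H (V p) (U p)"
    if "vector_field A U" "vector_field A V" for U V
    unfolding H_def by (rule torsion_eq_difference[OF D LC that])
  have bilH: "bilinear H" unfolding H_def by (rule bilinear_difference_at[OF D N])
  have n: "n (U p) = N U B p" if "vector_field A U" for U
    using H[OF that B] DB[OF that] unfolding n_def by (metis diff_0 minus_minus)
  let ?e = "extend_vector A p"
  \<comment> \<open>D and N are both metric, so the directional derivative cancels in the difference
    of the two product rules.\<close>
  have skew: "\<alpha> p (H u v) w = - \<alpha> p (H u w) v" for u v w
    using metricD[of "?e u" "?e v" "?e w" p] metricN[of "?e u" "?e v" "?e w" p]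
      H[of "?e u" "?e v", symmetric] H[of "?e u" "?e w", symmetric] g.commute[of p v]
    by (simp add: extend_vector g.simps)

  have sym: "\<alpha> p (H u v - H v u) w = \<alpha> p (H u w - H w u) v"
    if orth: "\<alpha> p v (B p) = 0" "\<alpha> p w (B p) = 0" for u v w
  proof -
    \<comment> \<open>Projection to the complement of B at every point. The coefficient 1/K^2 is the
      same everywhere because B has constant length, and at p the vectors v and w are left
      unchanged.\<close>
    define P where "P V q = V q + ((- inverse (K\<^sup>2)) * \<beta> q (V q)) *\<^sub>R B q" for V :: "'m \<Rightarrow> 'e" and q
    have P: "vector_field A (P V)" if "vector_field A V" for V
      unfolding P_def
      by (intro vector_field_add vector_field_scale smooth_function_mult smooth_function_const
          smooth_function_one_form[OF \<beta>] that B)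
    have bP: "\<beta> q (P V q) = 0" for V q
      using BB[of q] \<open>K \<noteq> 0\<close> by (simp add: P_def dual g.simps)
    have Pp: "P (?e v) p = v" "P (?e w) p = w"
      using orth by (simp_all add: P_def dual extend_vector g.commute[of p "B p"])
    let ?E = "SOME E. orthonormal_basis \<alpha> p E"
    define S where "S v' w' = \<alpha> p v' u *\<^sub>R (\<alpha> p w' v *\<^sub>R w - \<alpha> p w' w *\<^sub>R v)" for v' w'
    show ?thesis
    proof (rule g.minimal_imp_symmetric[where E = ?E and T = "\<lambda>u v. H u v - H v u" and S = S])
      show "independent ?E" "span ?E = UNIV"
        "\<And>u v. u \<in> ?E \<Longrightarrow> v \<in> ?E \<Longrightarrow> \<alpha> p u v = (if u = v then 1 else 0)"
        using orthonormal_basis_some[OF \<alpha>, of p] unfolding orthonormal_basis_def by blast+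
      show "bilinear (\<lambda>u v. H u v - H v u)"
        using bilH by (auto simp: bilinear_def intro!: linear_compose_sub)
      show "S v' w' = \<alpha> p v' u *\<^sub>R (\<alpha> p w' v *\<^sub>R w - \<alpha> p w' w *\<^sub>R v)" for v' w'
        by (rule S_def)
      fix r
      \<comment> \<open>This competitor is compatible for each r, and its torsion at p is that of D
        plus r times the alternation of S.\<close>
      let ?D = "vary \<alpha> (?e u) (P (?e v)) (P (?e w)) D r"
      have t: "torsion_at A D p v' w' = H v' w' - H w' v'" for v' w'
        using T[of "?e v'" "?e w'"] by (simp add: torsion_at_def extend_vector)
      have "torsion_at A ?D p v' w' = (H v' w' - H w' v') + r *\<^sub>R (S v' w' - S w' v')" for v' w'
        using t[of v' w'] by (simp add: torsion_at_def torsion_vary extend_vector Pp S_def)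
      then show "(\<Sum>u\<in>?E. \<Sum>v\<in>?E. \<alpha> p (H u v - H v u) (H u v - H v u)) \<le>
          (\<Sum>u\<in>?E. \<Sum>v\<in>?E. \<alpha> p (H u v - H v u + r *\<^sub>R (S u v - S v u))
            (H u v - H v u + r *\<^sub>R (S u v - S v u)))"
        using min[of ?D p, OF linear_connection_vary[OF D \<alpha>] compatible_vary[OF D comp \<alpha> \<beta>]]
        by (simp add: torsion_norm_sq_eq[OF \<alpha>] t extend_vector P bP)
    qed (simp_all add: nonneg)
  qed

  \<comment> \<open>N being torsion-free, the bracket is N_U V - N_V U. The product rule for
    \<alpha>(B, _) cancels these terms and leaves the antisymmetrization of N B, which matches the
    linear algebra formula.\<close>
  have ext: "ext_deriv A \<beta> U V p = \<alpha> p (n (U p)) (V p) - \<alpha> p (n (V p)) (U p)"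
    if U: "vector_field A U" and V: "vector_field A V" for U V
  proof -
    have "lie_bracket A U V p = N U V p - N V U p"
      using LC U V by (simp add: levi_civita_def torsion_def)
    then show ?thesis
      using metricN[OF U B V, of p] metricN[OF V B U, of p]
      by (simp add: ext_deriv_def dual n[OF U] n[OF V] g.simps)
  qed
  show "\<alpha> p (torsion A D X Y p) (Z p) =
        \<alpha> p (T_circ \<alpha> B N K X Y p) (Z p)
        + (\<beta> p (Y p) * ext_deriv A \<beta> X Z p - \<beta> p (X p) * ext_deriv A \<beta> Y Z p) / (2 * K\<^sup>2)
        + (\<beta> p (X p) * ext_deriv A \<beta> Y B p - \<beta> p (Y p) * ext_deriv A \<beta> X B p) / (2 * K ^ 4)
          * \<beta> p (Z p)"
    unfolding T[OF X Y] ext[OF X Z] ext[OF Y Z] ext[OF X B] ext[OF Y B] T_circ_def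
      n[OF X, symmetric] n[OF Y, symmetric] dual
    by (rule g.extremal_torsion_formula[OF bilH skew BB \<open>K \<noteq> 0\<close> _ sym]) (simp_all add: n_def)
qed

end
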